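(* Let $\mathcal{A}$ be a finite alphabet and let $X\subseteq\mathcal{A}^{\mathbb{Z}}$ be a topologically mixing subshift that is entropy stable. Then $X$ supports a characteristic measure, that is, there is a Borel probability measure $\mu$ on $X$ such that $\varphi_*\mu=\mu$ for every $\varphi\in\mathrm{Aut}(X,\sigma)$.
   Context: A subshift $X\subseteq\mathcal{A}^{\mathbb{Z}}$ ($\mathcal{A}$ a finite alphabet) is a nonempty, closed set invariant under the left shift $\sigma$, $(\sigma x)(n)=x(n+1)$. $\mathrm{Aut}(X,\sigma)$ is the group of homeomorphisms $\varphi\colon X\to X$ with $\varphi\circ\sigma=\sigma\circ\varphi$. $\mathcal{L}_n(X)$ is the set of words of length $n$ that occur in some element of $X$, and $\mathcal{L}(X)=\bigcup_n\mathcal{L}_n(X)$. $X$ is topologically transitive if for all $u,v\in\mathcal{L}(X)$ there is a word $w$ with $uwv\in\mathcal{L}(X)$; $X$ is topologically mixing if for all $u,v\in\mathcal{L}(X)$ there is $N$ such that for all $n\geq N$ there is $w\in\mathcal{L}_n(X)$ with $uwv\in\mathcal{L}(X)$. The SFT cover of $X$ is the sequence $\{X_n\}_{n\geq 1}$, where $X_n$ is the set of all $x\in\mathcal{A}^{\mathbb{Z}}$ in which no word of $\bigcup_{k=1}^n(\mathcal{A}^k\setminus\mathcal{L}_k(X))$ occurs. $h_{\mathrm{top}}$ denotes topological entropy (natural logarithm). For a positive integer $s$ put $$\xi(s)=\frac{30\,s^{3(s^2+1)}}{1-\left(1-\frac{1}{4s^{2s^2}}\right)^{1/s^2}}.$$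 A topologically transitive subshift $X$ is entropy stable if for every $\varepsilon>0$ and all integers $\ell,j\geq 1$ there is an integer $m=m(\varepsilon,\ell,j)\geq 1$ such that $$\bigl|h_{\mathrm{top}}(X_m)-h_{\mathrm{top}}(X_{m+j})\bigr|<\frac{\varepsilon^2}{\left(\frac43\right)^{2\ell}\xi(s_m)^2},$$ where $s_m=|\mathcal{L}_m(X_m)|$ is the number of admissible words of length $m$ in $X_m$. *)

theory Defs
  imports "HOL-Probability.Probability"
begin

text \<open>
  A finite alphabet is a type of sort \<open>{finite, discrete_topology}\<close>, so that the library topology
  on \<open>int \<Rightarrow> 'a\<close> is the product of discrete topologies and \<open>borel\<close> is its Borel sigma-algebra.
\<close>

definition shift :: "(int \<Rightarrow> 'a) \<Rightarrow> (int \<Rightarrow> 'a)" where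
  "shift x = (\<lambda>n. x (n + 1))"

text \<open>Two-sided setting: invariance means \<open>\<sigma> X = X\<close>.\<close>

definition subshift :: "(int \<Rightarrow> 'a :: discrete_topology) set \<Rightarrow> bool" where
  "subshift X \<longleftrightarrow> X \<noteq> {} \<and> closed X \<and> shift ` X = X"

text \<open>
  Automorphisms of \<open>X\<close> are represented by total functions whose values outside \<open>X\<close> are irrelevant.
\<close>

definition Aut :: "(int \<Rightarrow> 'a :: discrete_topology) set \<Rightarrow> ((int \<Rightarrow> 'a) \<Rightarrow> (int \<Rightarrow> 'a)) set" where
  "Aut X = {\<phi>. (\<exists>\<psi>. homeomorphism X X \<phi> \<psi>) \<and> (\<forall>x\<in>X. \<phi> (shift x) = shift (\<phi> x))}"

definition occurs_in :: "'a list \<Rightarrow> (int \<Rightarrow> 'a) \<Rightarrow> bool" where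
  "occurs_in w x \<longleftrightarrow> (\<exists>i. \<forall>k < length w. x (i + int k) = w ! k)"

definition words :: "(int \<Rightarrow> 'a) set \<Rightarrow> nat \<Rightarrow> 'a list set" where
  "words X n = {w. length w = n \<and> (\<exists>x\<in>X. occurs_in w x)}"

definition language :: "(int \<Rightarrow> 'a) set \<Rightarrow> 'a list set" where
  "language X = (\<Union>n. words X n)"

definition topologically_transitive :: "(int \<Rightarrow> 'a) set \<Rightarrow> bool" where
  "topologically_transitive X \<longleftrightarrow>
     (\<forall>u\<in>language X. \<forall>v\<in>language X. \<exists>w. u @ w @ v \<in> language X)"

definition topologically_mixing :: "(int \<Rightarrow> 'a) set \<Rightarrow> bool" where
  "topologically_mixing X \<longleftrightarrow>
     (\<forall>u\<in>language X. \<forall>v\<in>language X. \<exists>N. \<forall>n\<ge>N. \<exists>w\<in>words X n. u @ w @ v \<in> language X)"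

definition SFT_cover :: "(int \<Rightarrow> 'a) set \<Rightarrow> nat \<Rightarrow> (int \<Rightarrow> 'a) set" where
  "SFT_cover X n =
     {x. \<forall>w \<in> (\<Union>k\<in>{1..n}. {w. length w = k} - words X k). \<not> occurs_in w x}"

text \<open>
  Topological entropy of a subshift: the exponential growth rate (natural logarithm) of the
  number of admissible words. The limit exists for every subshift over a finite alphabet.
\<close>

definition h_top :: "(int \<Rightarrow> 'a) set \<Rightarrow> real" where
  "h_top X = lim (\<lambda>n. ln (real (card (words X n))) / real n)"

definition \<xi> :: "nat \<Rightarrow> real" where
  "\<xi> s = 30 * real s ^ (3 * (s\<^sup>2 + 1)) /
         (1 - (1 - 1 / (4 * real s ^ (2 * s\<^sup>2))) powr (1 / real (s\<^sup>2)))"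

definition entropy_stable :: "(int \<Rightarrow> 'a :: discrete_topology) set \<Rightarrow> bool" where
  "entropy_stable X \<longleftrightarrow> subshift X \<and> topologically_transitive X \<and>
     (\<forall>\<epsilon>::real. \<forall>l j :: nat. \<epsilon> > 0 \<longrightarrow> l \<ge> 1 \<longrightarrow> j \<ge> 1 \<longrightarrow>
       (\<exists>m\<ge>1. \<bar>h_top (SFT_cover X m) - h_top (SFT_cover X (m + j))\<bar>
              < \<epsilon>\<^sup>2 / ((4 / 3) ^ (2 * l) * (\<xi> (card (words (SFT_cover X m) m)))\<^sup>2)))"

definition characteristic_measure ::
    "(int \<Rightarrow> 'a :: discrete_topology) set \<Rightarrow> (int \<Rightarrow> 'a) measure \<Rightarrow> bool" where
  "characteristic_measure X \<mu> \<longleftrightarrow>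
     prob_space \<mu> \<and> sets \<mu> = sets (restrict_space borel X) \<and> (\<forall>\<phi>\<in>Aut X. distr \<mu> \<mu> \<phi> = \<mu>)"

end

theory Submission
  imports Defs
begin

text \<open>
  An automorphism \<open>\<phi>\<close> of \<open>X\<close> and its inverse are given by local rules of some radius \<open>R\<close>.
  The same rule, read on the points of \<open>Z = X\<^bsub>m+4R+1\<^esub>\<close>, still makes sense, takes values in
  \<open>Y = X\<^sub>m\<close> and is injective, because every window on which these facts depend is a word of \<open>X\<close>.
  The words of length \<open>n\<close> of \<open>Z\<close> thus appear twice among the words of \<open>Y\<close>: as themselves and
  as images under the rule. Each copy has about \<open>exp (n h(Z))\<close> members, while \<open>Y\<close> has about
  \<open>exp (n h(Y))\<close> words. If \<open>\<delta> = h(Y) - h(Z)\<close> is small compared with the rate at which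
  frequencies concentrate in \<open>Y\<close>, then both copies see every pattern with almost the same average
  frequency, so the empirical measure of \<open>Z\<close> is almost \<open>\<phi>\<close>-invariant. The point of entropy
  stability is that \<open>m\<close> may be chosen after \<open>R\<close>.

  The concentration is measured as follows. Let \<open>P(t)\<close> be the exponential growth rate of the sum
  of \<open>exp (t S(z))\<close> over the words \<open>z\<close> of \<open>Y\<close>, where \<open>S(z)\<close> counts the occurrences of the
  pattern. By Jensen's inequality a set of \<open>exp (n h(Z))\<close> words has a mean frequency of at most
  \<open>(P(t) - h(Z)) / t\<close> in the limit, and at least \<open>- (P(-t) - h(Z)) / t\<close>
  (\<open>birkhoff_sums_close\<close>). Two such means differ by at most
  \<open>(P(t) + P(-t) - 2 P(0) + 2 \<delta>) / t\<close>, so everything rests on a bound \<open>C t\<^sup>2\<close> for the second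
  difference of \<open>P\<close> (\<open>pressure_second_difference\<close>). Here \<open>exp (P(t))\<close> is the Perron eigenvalue of a weighted
  transfer operator on the overlap graph of words. Let \<open>v\<^sub>+\<close> and \<open>v\<^sub>-\<close> be the eigenvectors
  for \<open>t\<close> and \<open>-t\<close>. Their quotient is constant up to \<open>O(t)\<close>, by a maximum principle
  (\<open>eigenvector_quotient_near_constant\<close>), and then a reverse Cauchy-Schwarz inequality for the test
  vector \<open>sqrt (v\<^sub>+ v\<^sub>-)\<close> bounds the eigenvalue at \<open>0\<close> from below by the geometric mean of the
  other two, up to a factor \<open>1 - O(t\<^sup>2)\<close> (\<open>eigenvalue_product_le\<close>). With \<open>s\<close> vertices one gets
  \<open>C = 64 s\<^bsup>2s\<^sup>2+2s+2\<^esup> \<le> (\<xi> s)\<^sup>2\<close>, and \<open>t\<close> of order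
  \<open>\<epsilon> / (\<xi> s)\<^sup>2\<close> makes both \<open>C t\<close> and \<open>\<delta> / t\<close> of order \<open>\<epsilon>\<close>.

  The set functions with values in \<open>[0, 1]\<close> form a compact space in which finite additivity,
  full mass on \<open>X\<close> and invariance on sets that depend on finitely many coordinates are closed
  conditions. Any finitely many of them can be met up to \<open>\<epsilon>\<close> by an empirical content
  (\<open>almost_invariant_content\<close>), hence all of them at once (\<open>invariant_content\<close>). Sets that depend
  on finitely many coordinates are compact, so the content is continuous at the empty set on their
  algebra, and Caratheodory's theorem turns it into the measure.
\<close>

section \<open>Perron eigenvectors of strongly connected digraphs\<close>

lemma compact_pointwise_box:
  fixes S :: "'b \<Rightarrow> 'c::topological_space set"
  assumes "\<And>i. compact (S i)"
  shows "compact {x. \<forall>i. x i \<in> S i}"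
proof -
  have "compactin (product_topology (\<lambda>i. euclidean) UNIV) (PiE UNIV S)"
    using assms by (simp add: compactin_PiE)
  moreover have "PiE UNIV S = {x. \<forall>i. x i \<in> S i}"
    by auto
  ultimately show ?thesis
    by (simp add: euclidean_product_topology)
qed

text \<open>
  The constant \<open>C\<close> in the bound \<open>C t\<^sup>2\<close> for the second difference of the logarithm of the
  Perron eigenvalue on a graph with \<open>n\<close> vertices. The exponent arises as twice
  \<open>n\<^sup>2 + n + 1\<close>: transition probabilities are bounded below by about \<open>n\<^bsup>-(n+1)\<^esup>\<close>, the
  maximum principle loses this factor once on each of at most \<open>n\<close> steps, and the steps are summed.
\<close>

definition curvature :: "nat \<Rightarrow> real" where
  "curvature n = 64 * real n ^ (2 * n\<^sup>2 + 2 * n + 2)"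

locale strong_digraph =
  fixes V :: "'v set" and E :: "('v \<times> 'v) set"
  assumes finite_V: "finite V"
    and V_nonempty: "V \<noteq> {}"
    and E_sub: "E \<subseteq> V \<times> V"
    and connected: "\<lbrakk>u \<in> V; v \<in> V\<rbrakk> \<Longrightarrow> (u, v) \<in> E\<^sup>+"
begin

lemma leaving_edge:
  assumes "S \<subseteq> V" "S \<noteq> {}" "S \<noteq> V"
  shows "\<exists>u\<in>S. \<exists>v\<in>V - S. (u, v) \<in> E"
proof (rule ccontr)
  assume none: "\<not> ?thesis"
  have closed: "v \<in> S" if "u \<in> S" "(u, v) \<in> E" for u v
    using that none E_sub by blast
  obtain a b where a: "a \<in> S" and b: "b \<in> V" "b \<notin> S"
    using assms by blast
  have "(a, b) \<in> E\<^sup>+"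
    using connected a b assms(1) by blast
  then have "b \<in> S"
    by (induction rule: trancl_induct) (use a closed in blast)+
  with b show False by simp
qed

text \<open>
  The set where \<open>z \<le> b k\<close> gains a new vertex with every step until it is all of \<open>V\<close>, so
  \<open>card V\<close> steps suffice. Counting in this way yields a bound by the number of vertices without
  choosing shortest paths.
\<close>

lemma propagate:
  fixes z :: "'v \<Rightarrow> real" and b :: "nat \<Rightarrow> real"
  assumes "mono b" "u0 \<in> V" "z u0 \<le> b 0"
    and step: "\<And>k u v. (u, v) \<in> E \<Longrightarrow> z u \<le> b k \<Longrightarrow> z v \<le> b (Suc k)"
    and "v \<in> V"
  shows "z v \<le> b (card V)"
proof -
  define S where "S k = {v \<in> V. z v \<le> b k}" for k
  have fin: "finite (S k)" for k
    using finite_V by (simp add: S_def)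
  have mono_S: "S k \<subseteq> S (Suc k)" for k
    using monoD[OF \<open>mono b\<close>, of k "Suc k"] by (force simp: S_def)
  have grow: "S k = V \<or> Suc k \<le> card (S k)" for k
  proof (induction k)
    case 0
    have "u0 \<in> S 0" using assms by (simp add: S_def)
    then show ?case
      using fin[of 0] by (metis One_nat_def Suc_leI card_gt_0_iff empty_iff)
  next
    case (Suc k)
    show ?case
    proof (cases "S k = V")
      case True
      then show ?thesis using mono_S[of k] by (auto simp: S_def)
    next
      case False
      then have "S k \<noteq> {}" using Suc by auto
      then obtain u v where uv: "u \<in> S k" "v \<in> V - S k" "(u, v) \<in> E"
        using leaving_edge[of "S k"] False by (auto simp: S_def)
      then have "v \<in> S (Suc k)"
        using step[of u v k] by (auto simp: S_def)
      then have "S k \<subset> S (Suc k)"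
        using mono_S[of k] uv by blast
      then have "card (S k) < card (S (Suc k))"
        using fin psubset_card_mono by blast
      with Suc False show ?thesis by auto
    qed
  qed
  have "card (S (card V)) \<le> card V"
    using finite_V by (intro card_mono) (auto simp: S_def)
  then have "S (card V) = V"
    using grow[of "card V"] by linarith
  then show ?thesis
    using \<open>v \<in> V\<close> by (auto simp: S_def)
qed

text \<open>
  The weights sit on the target vertex of an edge, which matches the way in which appending a letter
  to a word adds one more window.
\<close>

definition transfer :: "('v \<Rightarrow> real) \<Rightarrow> ('v \<Rightarrow> real) \<Rightarrow> 'v \<Rightarrow> real" where
  "transfer a r u = (\<Sum>v\<in>E `` {u}. a v * r v)"

lemma succ_sub: "E `` {u} \<subseteq> V"
  using E_sub by auto

lemma finite_succ: "finite (E `` {u})"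
  using succ_sub finite_V finite_subset by blast

lemma succ_nonempty: "u \<in> V \<Longrightarrow> E `` {u} \<noteq> {}"
  using connected[of u u] by (auto dest: tranclD)

definition eigen :: "('v \<Rightarrow> real) \<Rightarrow> real \<Rightarrow> ('v \<Rightarrow> real) \<Rightarrow> bool" where
  "eigen a l r \<longleftrightarrow> (\<forall>u\<in>V. 0 < r u \<and> transfer a r u = l * r u)"

definition super_eigen :: "('v \<Rightarrow> real) \<Rightarrow> real \<Rightarrow> ('v \<Rightarrow> real) \<Rightarrow> bool" where
  "super_eigen a c r \<longleftrightarrow> (\<forall>u\<in>V. 0 < r u \<and> transfer a r u \<le> c * r u)"

lemma transfer_edge_le:
  assumes "\<And>v. v \<in> V \<Longrightarrow> 0 < a v" "\<And>v. v \<in> V \<Longrightarrow> 0 \<le> r v" "(u, v) \<in> E"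
  shows "a v * r v \<le> transfer a r u"
  unfolding transfer_def using assms succ_sub[of u]
  by (intro member_le_sum finite_succ) (auto intro!: mult_nonneg_nonneg dest: less_imp_le)

lemma transfer_mono:
  assumes "\<And>v. v \<in> V \<Longrightarrow> 0 < a v" "\<And>v. v \<in> V \<Longrightarrow> r v \<le> r' v"
  shows "transfer a r u \<le> transfer a r' u"
  unfolding transfer_def using assms succ_sub[of u]
  by (intro sum_mono mult_left_mono) (auto intro: less_imp_le)

lemma transfer_pos:
  assumes "\<And>v. v \<in> V \<Longrightarrow> 0 < a v" "\<And>v. v \<in> V \<Longrightarrow> 0 < r v" "u \<in> V"
  shows "0 < transfer a r u"
  unfolding transfer_def using assms succ_sub[of u]
  by (intro sum_pos finite_succ succ_nonempty) (auto intro: mult_pos_pos)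

text \<open>
  The normalised vectors that are super-eigenvectors for values slightly above the infimum form a
  decreasing family of nonempty compact sets. A common element is nonnegative, and strong
  connectedness makes it positive: a zero entry would force zeros at all successors.
\<close>

lemma min_super_eigen:
  assumes a: "\<And>v. v \<in> V \<Longrightarrow> 0 < a v"
  shows "\<exists>c x. super_eigen a c x \<and> (\<forall>c' x'. super_eigen a c' x' \<longrightarrow> c \<le> c')"
proof -
  define T where "T = {c. \<exists>x. super_eigen a c x}"
  have T_pos: "0 \<le> c" if "c \<in> T" for c
  proof -
    obtain x where x: "super_eigen a c x" using \<open>c \<in> T\<close> by (auto simp: T_def)
    obtain u where u: "u \<in> V" using V_nonempty by blast
    have "0 < transfer a x u"
      using x u a by (intro transfer_pos) (auto simp: super_eigen_def)
    then have "0 < c * x u" "0 < x u" using x u by (force simp: super_eigen_def)+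
    then show ?thesis by (simp add: zero_less_mult_iff)
  qed
  then have bdd: "bdd_below T" by (auto simp: bdd_below_def)
  have "super_eigen a (\<Sum>v\<in>V. a v) (\<lambda>_. 1)"
    unfolding super_eigen_def transfer_def
    using a finite_V succ_sub by (auto intro!: sum_mono2 dest: less_imp_le)
  then have T_ne: "T \<noteq> {}" by (auto simp: T_def)
  define c where "c = Inf T"
  have c_nonneg: "0 \<le> c"
    unfolding c_def using T_ne T_pos by (intro cInf_greatest)
  define Q where "Q = {x :: 'v \<Rightarrow> real. \<forall>v. x v \<in> {0..1}}"
  define K where "K n = {x. (\<Sum>v\<in>V. x v) = 1 \<and>
      (\<forall>u\<in>V. transfer a x u \<le> (c + 1 / (real n + 1)) * x u)}" for n :: nat
  have "Q \<inter> (\<Inter>n\<in>UNIV. K n) \<noteq> {}"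
  proof (rule compact_imp_fip_image)
    show "compact Q"
      unfolding Q_def by (intro compact_pointwise_box) simp
    show "closed (K n)" for n
    proof -
      have "K n = {x. (\<Sum>v\<in>V. x v) = 1} \<inter>
         (\<Inter>u\<in>V. {x. transfer a x u \<le> (c + 1 / (real n + 1)) * x u})"
        using V_nonempty by (auto simp: K_def)
      also have "closed \<dots>"
        unfolding transfer_def
        by (intro closed_Int closed_INT ballI closed_Collect_eq closed_Collect_le
            continuous_intros continuous_on_product_coordinates)
      finally show ?thesis .
    qed
    fix I :: "nat set" assume I: "finite I"
    define N where "N = (if I = {} then 0 else Max I)"
    have N: "n \<le> N" if "n \<in> I" for n
      using that I by (auto simp: N_def)
    have "Inf T < c + 1 / (real N + 1)" by (simp add: c_def)
    then obtain d where d: "d \<in> T" "d < c + 1 / (real N + 1)"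
      using cInf_lessD[OF T_ne] by blast
    then obtain x where x: "super_eigen a d x" by (auto simp: T_def)
    define s where "s = (\<Sum>v\<in>V. x v)"
    have s: "0 < s"
      unfolding s_def using x finite_V V_nonempty by (intro sum_pos) (auto simp: super_eigen_def)
    define y where "y v = (if v \<in> V then x v / s else 0)" for v
    have sum_y: "(\<Sum>v\<in>V. y v) = 1"
      using s by (simp add: y_def s_def flip: sum_divide_distrib)
    have y_nonneg: "0 \<le> y v" for v
      using x s by (auto simp: y_def super_eigen_def intro: less_imp_le)
    have "y \<in> Q"
    proof -
      have "y v \<le> 1" for v
      proof (cases "v \<in> V")
        case True
        then have "y v \<le> (\<Sum>v\<in>V. y v)"
          using y_nonneg finite_V by (intro member_le_sum) auto
        then show ?thesis using sum_y by simp
      qed (simp add: y_def)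
      then show ?thesis using y_nonneg by (simp add: Q_def)
    qed
    moreover have "y \<in> K n" if "n \<in> I" for n
    proof -
      have "transfer a y u \<le> (c + 1 / (real n + 1)) * y u" if u: "u \<in> V" for u
      proof -
        have "transfer a y u = transfer a x u / s"
          unfolding transfer_def sum_divide_distrib using succ_sub[of u]
          by (intro sum.cong) (auto simp: y_def)
        also have "\<dots> \<le> d * x u / s"
          using x s u by (intro divide_right_mono) (auto simp: super_eigen_def)
        also have "\<dots> = d * y u" using u by (simp add: y_def)
        also have "\<dots> \<le> (c + 1 / (real N + 1)) * y u"
          using d y_nonneg by (intro mult_right_mono) auto
        also have "\<dots> \<le> (c + 1 / (real n + 1)) * y u"
          using N[OF \<open>n \<in> I\<close>] y_nonneg by (intro mult_right_mono add_left_mono divide_left_mono) auto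
        finally show ?thesis .
      qed
      then show ?thesis using sum_y by (simp add: K_def)
    qed
    ultimately show "Q \<inter> (\<Inter>n\<in>I. K n) \<noteq> {}" by blast
  qed
  then obtain x where xQ: "x \<in> Q" and xK: "\<And>n. x \<in> K n" by blast
  have x_nonneg: "0 \<le> x v" for v using xQ by (simp add: Q_def)
  have sum_x: "(\<Sum>v\<in>V. x v) = 1" using xK[of 0] by (simp add: K_def)
  have x_le: "transfer a x u \<le> c * x u" if u: "u \<in> V" for u
  proof (rule LIMSEQ_le_const)
    have "(\<lambda>n. 1 / (real n + 1)) \<longlonglongrightarrow> 0"
      using LIMSEQ_inverse_real_of_nat by (simp add: inverse_eq_divide add.commute)
    then have "(\<lambda>n. (c + 1 / (real n + 1)) * x u) \<longlonglongrightarrow> (c + 0) * x u"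
      by (intro tendsto_intros)
    then show "(\<lambda>n. (c + 1 / (real n + 1)) * x u) \<longlonglongrightarrow> c * x u" by simp
    show "\<exists>N. \<forall>n\<ge>N. transfer a x u \<le> (c + 1 / (real n + 1)) * x u"
      using xK u by (auto simp: K_def)
  qed
  have x_pos: "0 < x u" if "u \<in> V" for u
  proof (rule ccontr)
    assume "\<not> 0 < x u"
    then have "u \<in> {u \<in> V. x u = 0}" using x_nonneg[of u] that by auto
    moreover have "{u \<in> V. x u = 0} \<noteq> V"
      using sum_x by (metis (mono_tags, lifting) mem_Collect_eq sum.neutral zero_neq_one)
    ultimately obtain u v where uv: "u \<in> V" "x u = 0" "v \<in> V" "x v \<noteq> 0" "(u, v) \<in> E"
      using leaving_edge[of "{u \<in> V. x u = 0}"] by blast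
    have "a v * x v \<le> transfer a x u"
      using a x_nonneg uv by (intro transfer_edge_le)
    also have "\<dots> \<le> 0" using x_le[of u] uv by simp
    finally show False
      using a[of v] uv x_nonneg[of v] by (simp add: mult_le_0_iff)
  qed
  have "super_eigen a c x" using x_le x_pos by (simp add: super_eigen_def)
  moreover have "c \<le> c'" if "super_eigen a c' x'" for c' x'
    unfolding c_def using that bdd by (intro cInf_lower) (auto simp: T_def)
  ultimately show ?thesis by blast
qed

text \<open>
  Strictness spreads backwards along edges. Lowering the entries at the strict vertices by a small
  amount keeps those vertices strict, and makes every predecessor of them strict as well.
\<close>

lemma super_eigen_all_strict:
  assumes a: "\<And>v. v \<in> V \<Longrightarrow> 0 < a v"
    and "super_eigen a c x" "u \<in> V" "transfer a x u < c * x u"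
  shows "\<exists>y. \<forall>u\<in>V. 0 < y u \<and> transfer a y u < c * y u"
  using assms(2-)
proof (induction "card {u \<in> V. transfer a x u = c * x u}" arbitrary: x u rule: less_induct)
  case less
  define S where "S = {u \<in> V. transfer a x u < c * x u}"
  have x: "0 < x u" "transfer a x u \<le> c * x u" if "u \<in> V" for u
    using less.prems that by (auto simp: super_eigen_def)
  have tp: "0 < transfer a x u" if "u \<in> V" for u
    using a x that by (intro transfer_pos) auto
  have c: "0 < c"
    using x[OF \<open>u \<in> V\<close>] tp[OF \<open>u \<in> V\<close>] by (metis mult_less_0_iff order_less_le_trans zero_less_mult_pos2)
  show ?case
  proof (cases "S = V")
    case True
    then show ?thesis using x unfolding S_def by blast
  next
    case False
    have "V - S \<noteq> {}" "V - S \<noteq> V" using False less.prems by (auto simp: S_def)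
    then obtain p q where pq: "p \<in> V" "p \<notin> S" "q \<in> S" "(p, q) \<in> E"
      using leaving_edge[of "V - S"] by blast
    have fin: "finite S" using finite_V by (simp add: S_def)
    define gap where "gap w = min (x w / 2) ((c * x w - transfer a x w) / (2 * c))" for w
    define e where "e = Min (gap ` S)"
    have e_le: "e \<le> gap w" if "w \<in> S" for w
      using that fin by (simp add: e_def)
    have e_pos: "0 < e"
      unfolding e_def using fin pq x c by (subst Min_gr_iff) (auto simp: gap_def S_def)
    define y where "y w = (if w \<in> S then x w - e else x w)" for w
    have y_le: "y w \<le> x w" for w using e_pos by (simp add: y_def)
    have y_pos: "0 < y w" if "w \<in> V" for w
    proof (cases "w \<in> S")
      case True
      then show ?thesis using e_le[OF True] x[OF that] by (simp add: y_def gap_def)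
    qed (use x[OF that] in \<open>simp add: y_def\<close>)
    have ty: "transfer a y w \<le> transfer a x w" for w
      using a y_le by (intro transfer_mono)
    have strict_S: "transfer a y w < c * y w" if "w \<in> S" for w
    proof -
      have "e \<le> (c * x w - transfer a x w) / (2 * c)"
        using e_le[OF that] by (simp add: gap_def)
      then have "2 * c * e \<le> c * x w - transfer a x w"
        using c by (simp add: pos_le_divide_eq mult.commute)
      moreover have "0 < c * e" using c e_pos by simp
      ultimately have "transfer a x w < c * (x w - e)"
        by (simp add: algebra_simps)
      then show ?thesis using ty[of w] that by (simp add: y_def)
    qed
    have weak: "transfer a y w \<le> c * y w" if "w \<in> V" for w
      using strict_S[of w] ty[of w] x[OF that] by (cases "w \<in> S") (auto simp: y_def)
    have strict_p: "transfer a y p < c * y p"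
    proof -
      have "transfer a y p < transfer a x p"
        unfolding transfer_def
      proof (rule sum_strict_mono_ex1[OF finite_succ])
        show "\<forall>v\<in>E `` {p}. a v * y v \<le> a v * x v"
          using y_le a succ_sub[of p] by (auto intro!: mult_left_mono dest: less_imp_le)
        show "\<exists>v\<in>E `` {p}. a v * y v < a v * x v"
          using pq a[of q] e_pos by (intro bexI[of _ q]) (auto simp: y_def S_def)
      qed
      then show ?thesis using x[OF \<open>p \<in> V\<close>] pq by (simp add: y_def)
    qed
    have "{u \<in> V. transfer a y u = c * y u} \<subset> {u \<in> V. transfer a x u = c * x u}"
    proof (rule psubsetI)
      show "{u \<in> V. transfer a y u = c * y u} \<subseteq> {u \<in> V. transfer a x u = c * x u}"
      proof safe
        fix w assume w: "w \<in> V" "transfer a y w = c * y w"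
        then have "w \<notin> S" using strict_S[of w] by auto
        then show "transfer a x w = c * x w"
          using w x[of w] by (simp add: S_def)
      qed
      show "{u \<in> V. transfer a y u = c * y u} \<noteq> {u \<in> V. transfer a x u = c * x u}"
        using strict_p pq x[of p] by (force simp: S_def)
    qed
    then have "card {u \<in> V. transfer a y u = c * y u} < card {u \<in> V. transfer a x u = c * x u}"
      using finite_V by (intro psubset_card_mono) auto
    moreover have "super_eigen a c y" using weak y_pos by (simp add: super_eigen_def)
    ultimately show ?thesis
      using less.hyps strict_p pq by blast
  qed
qed

text \<open>
  A super-eigenvector for the least possible value is an eigenvector: if one inequality were strict,
  all could be made strict, and then the value could be lowered.
\<close>

lemma perron_eigenvector:
  assumes a: "\<And>v. v \<in> V \<Longrightarrow> 0 < a v"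
  shows "\<exists>l r. eigen a l r"
proof -
  obtain c x where cx: "super_eigen a c x"
    and least: "\<And>c' x'. super_eigen a c' x' \<Longrightarrow> c \<le> c'"
    using min_super_eigen[of a] a by blast
  have "transfer a x u = c * x u" if u: "u \<in> V" for u
  proof (rule ccontr)
    assume "transfer a x u \<noteq> c * x u"
    then have "transfer a x u < c * x u"
      using cx u by (force simp: super_eigen_def)
    then obtain y where y: "\<And>u. u \<in> V \<Longrightarrow> 0 < y u" "\<And>u. u \<in> V \<Longrightarrow> transfer a y u < c * y u"
      using super_eigen_all_strict[OF a cx u] by blast
    define c' where "c' = Max ((\<lambda>u. transfer a y u / y u) ` V)"
    have "transfer a y u \<le> c' * y u" if "u \<in> V" for u
    proof -
      have "transfer a y u / y u \<le> c'" unfolding c'_def using finite_V that by simp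
      then show ?thesis using y that by (simp add: pos_divide_le_eq)
    qed
    then have "super_eigen a c' y" using y by (simp add: super_eigen_def)
    moreover have "c' < c"
      unfolding c'_def using finite_V V_nonempty y by (subst Max_less_iff) (auto simp: pos_divide_less_eq)
    ultimately show False using least by force
  qed
  then show ?thesis using cx by (auto simp: eigen_def super_eigen_def)
qed

lemma eigen_pos: "eigen a l r \<Longrightarrow> u \<in> V \<Longrightarrow> 0 < r u"
  by (simp add: eigen_def)

lemma eigen_eq: "eigen a l r \<Longrightarrow> u \<in> V \<Longrightarrow> transfer a r u = l * r u"
  by (simp add: eigen_def)

lemma eigenvalue_pos:
  assumes "\<And>v. v \<in> V \<Longrightarrow> 0 < a v" "eigen a l r"
  shows "0 < l"
proof -
  obtain u where u: "u \<in> V" using V_nonempty by blast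
  have "0 < l * r u" "0 < r u"
    using transfer_pos[of a r u] assms u by (auto simp: eigen_def)
  then show ?thesis by (simp add: zero_less_mult_iff)
qed

text \<open>
  Compare \<open>w\<close> with the eigenvector at a vertex where the quotient \<open>w / r\<close> is largest.
\<close>

lemma sub_eigenvalue_le:
  assumes a: "\<And>v. v \<in> V \<Longrightarrow> 0 < a v" and r: "eigen a l r"
    and w: "\<And>u. u \<in> V \<Longrightarrow> 0 < w u" "\<And>u. u \<in> V \<Longrightarrow> \<theta> * w u \<le> transfer a w u"
  shows "\<theta> \<le> l"
proof -
  define c where "c = Max ((\<lambda>u. w u / r u) ` V)"
  have "c \<in> (\<lambda>u. w u / r u) ` V"
    unfolding c_def using finite_V V_nonempty by (intro Max_in) auto
  then obtain i where i: "i \<in> V" "c = w i / r i" by blast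
  have w_le: "w u \<le> c * r u" if "u \<in> V" for u
  proof -
    have "w u / r u \<le> c" unfolding c_def using finite_V that by simp
    then show ?thesis using eigen_pos[OF r that] by (simp add: pos_divide_le_eq)
  qed
  have "\<theta> * w i \<le> transfer a w i" using w i by simp
  also have "\<dots> \<le> transfer a (\<lambda>u. c * r u) i"
    using a w_le by (intro transfer_mono)
  also have "\<dots> = c * transfer a r i"
    by (simp add: transfer_def sum_distrib_left algebra_simps)
  also have "\<dots> = l * w i"
    using i eigen_eq[OF r \<open>i \<in> V\<close>] eigen_pos[OF r \<open>i \<in> V\<close>] by simp
  finally show ?thesis using w(1)[OF \<open>i \<in> V\<close>] by simp
qed

lemma eigenvalue_le:
  fixes A :: real
  assumes a: "\<And>v. v \<in> V \<Longrightarrow> 0 < a v" "\<And>v. v \<in> V \<Longrightarrow> a v \<le> A" and r: "eigen a l r"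
  shows "l \<le> card V * A"
proof -
  define c where "c = Max (r ` V)"
  have "c \<in> r ` V"
    unfolding c_def using finite_V V_nonempty by (intro Max_in) auto
  then obtain i where i: "i \<in> V" "c = r i" by blast
  have le: "r u \<le> c" if "u \<in> V" for u unfolding c_def using finite_V that by simp
  have c: "0 < c" using i eigen_pos[OF r] by simp
  have "l * c = (\<Sum>v\<in>E `` {i}. a v * r v)"
    using eigen_eq[OF r, of i] i by (simp add: transfer_def)
  also have "\<dots> \<le> (\<Sum>v\<in>E `` {i}. A * c)"
    using a le succ_sub[of i] eigen_pos[OF r] c
    by (intro sum_mono mult_mono) (force dest: less_imp_le intro: order_trans[OF less_imp_le])+
  also have "\<dots> = card (E `` {i}) * (A * c)" by simp
  also have "\<dots> \<le> card V * (A * c)"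
  proof (rule mult_right_mono)
    show "real (card (E `` {i})) \<le> real (card V)"
      using card_mono[OF finite_V succ_sub[of i]] by simp
    have "0 \<le> A" using a i by (meson less_imp_le order_trans)
    then show "0 \<le> A * c" using c by simp
  qed
  finally show ?thesis using c by (simp flip: mult.assoc)
qed

lemma eigenvalue_ge:
  assumes a: "\<And>v. v \<in> V \<Longrightarrow> b \<le> a v" "0 < b" and r: "eigen a l r"
  shows "b \<le> l"
proof (rule sub_eigenvalue_le[OF _ r, of "\<lambda>_. 1"])
  show a': "0 < a v" if "v \<in> V" for v using a that by (metis less_le_trans)
  show "b * 1 \<le> transfer a (\<lambda>_. 1) u" if "u \<in> V" for u
  proof -
    obtain v where "(u, v) \<in> E" using succ_nonempty[OF \<open>u \<in> V\<close>] by blast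
    then have "a v \<le> transfer a (\<lambda>_. 1) u"
      using transfer_edge_le[of a "\<lambda>_. 1" u v] a' by simp
    then show ?thesis using a \<open>(u, v) \<in> E\<close> E_sub by force
  qed
qed simp

text \<open>
  Along each edge the entry grows by at most the factor \<open>l / b\<close>, since a single summand of the
  transfer operator is bounded by the whole sum.
\<close>

lemma eigenvector_ratio:
  assumes a: "\<And>v. v \<in> V \<Longrightarrow> b \<le> a v" "0 < b" and r: "eigen a l r"
    and uv: "u \<in> V" "v \<in> V"
  shows "r v \<le> (l / b) ^ card V * r u"
proof (rule propagate[where z = r and ?u0.0 = u and b = "\<lambda>k. (l / b) ^ k * r u"])
  have a': "0 < a v" if "v \<in> V" for v using a that by (metis less_le_trans)
  have lb: "1 \<le> l / b" using eigenvalue_ge[OF a r] a by simp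
  show "mono (\<lambda>k. (l / b) ^ k * r u)"
    using lb eigen_pos[OF r \<open>u \<in> V\<close>] by (intro monoI mult_right_mono power_increasing) auto
  fix k p q assume pq: "(p, q) \<in> E" and p: "r p \<le> (l / b) ^ k * r u"
  have V: "p \<in> V" "q \<in> V" using pq E_sub by auto
  have "b * r q \<le> a q * r q"
    using a V eigen_pos[OF r] by (intro mult_right_mono) (auto dest: less_imp_le)
  also have "\<dots> \<le> transfer a r p"
    using a' eigen_pos[OF r] pq by (intro transfer_edge_le) (auto dest: less_imp_le)
  also have "\<dots> = l * r p" using eigen_eq[OF r] V by simp
  finally have "r q \<le> l / b * r p" using \<open>0 < b\<close> by (simp add: pos_le_divide_eq mult.commute)
  also have "\<dots> \<le> l / b * ((l / b) ^ k * r u)" using p lb by (intro mult_left_mono) auto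
  finally show "r q \<le> (l / b) ^ Suc k * r u" by simp
qed (use uv in auto)

section \<open>Second differences of the logarithm of the Perron eigenvalue\<close>

text \<open>
  Maximum principle. With respect to the Markov chain obtained by normalising the second eigenvalue
  equation, the quotient \<open>vp / vm\<close> is harmonic up to a factor \<open>exp (2 t)\<close>. Its maximum \<open>1\<close> is
  attained at \<open>i0\<close>, so the defect \<open>\<eta> = 1 - vp / vm\<close> has a small average over the successors of
  any vertex where it is small itself. Transition probabilities are at least \<open>1 / G\<close>, so the defect
  is small at each successor, with a loss of a factor \<open>G\<close> per step.
\<close>

lemma eigenvector_quotient_near_constant:
  fixes f :: "'v \<Rightarrow> real" and t :: real
  assumes f: "\<And>v. v \<in> V \<Longrightarrow> 0 \<le> f v" "\<And>v. v \<in> V \<Longrightarrow> f v \<le> 1" and t: "0 \<le> t"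
    and p: "eigen (\<lambda>v. exp (t * f v)) lp vp" and m: "eigen (\<lambda>v. exp (- t * f v)) lm vm"
    and le: "\<And>v. v \<in> V \<Longrightarrow> vp v \<le> vm v" and i0: "i0 \<in> V" "vp i0 = vm i0"
    and "v \<in> V"
  defines "G \<equiv> (lm * exp t) ^ Suc (card V)"
  shows "1 - vp v / vm v \<le> 2 * t * card V * G ^ card V"
proof (rule propagate[where z = "\<lambda>v. 1 - vp v / vm v" and ?u0.0 = i0
      and b = "\<lambda>k. 2 * t * real k * G ^ k", OF _ _ _ _ \<open>v \<in> V\<close>])
  note vp = eigen_pos[OF p] and vm = eigen_pos[OF m]
  have am: "exp (- t) \<le> exp (- t * f v)" if "v \<in> V" for v
    using f[OF that] t by (simp add: mult_left_le)
  have ratio: "vm v \<le> (lm * exp t) ^ card V * vm u" if "u \<in> V" "v \<in> V" for u v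
    using eigenvector_ratio[OF am _ m that] by (simp add: exp_minus divide_inverse)
  have lm: "exp (- t) \<le> lm" using eigenvalue_ge[OF am _ m] by simp
  then have lm_pos: "0 < lm" using exp_gt_zero less_le_trans by blast
  have H: "1 \<le> lm * exp t"
    using lm mult_right_mono[of "exp (-t)" lm "exp t"] by (simp flip: exp_add)
  have G: "1 \<le> G" unfolding G_def using H by (rule one_le_power)
  \<comment> \<open>as \<open>t \<ge> 0\<close>, the second eigenvector is a sub-eigenvector of the first operator\<close>
  have lmp: "lm \<le> lp"
  proof (rule sub_eigenvalue_le[OF _ p, of vm])
    show "lm * vm u \<le> transfer (\<lambda>v. exp (t * f v)) vm u" if "u \<in> V" for u
    proof -
      have "lm * vm u = transfer (\<lambda>v. exp (- t * f v)) vm u" using eigen_eq[OF m that] by simp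
      also have "\<dots> \<le> transfer (\<lambda>v. exp (t * f v)) vm u"
        unfolding transfer_def
      proof (rule sum_mono)
        fix w assume "w \<in> E `` {u}"
        then have w: "w \<in> V" using succ_sub by blast
        have "- t * f w \<le> t * f w" using t f[OF w] by simp
        then show "exp (- t * f w) * vm w \<le> exp (t * f w) * vm w"
          using vm[OF w] by (intro mult_right_mono) auto
      qed
      finally show ?thesis .
    qed
  qed (use vm in auto)
  show "mono (\<lambda>k. 2 * t * real k * G ^ k)"
    using G t by (intro monoI mult_mono power_increasing) auto
  show "i0 \<in> V" by fact
  show "1 - vp i0 / vm i0 \<le> 2 * t * real 0 * G ^ 0"
    using i0 vm[of i0] by simp
  fix k i j assume ij: "(i, j) \<in> E" and hyp: "1 - vp i / vm i \<le> 2 * t * real k * G ^ k"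
  have V: "i \<in> V" "j \<in> V" using ij E_sub by auto
  define \<eta> where "\<eta> v = 1 - vp v / vm v" for v
  have \<eta>: "0 \<le> \<eta> v" "vp v = vm v * (1 - \<eta> v)" if "v \<in> V" for v
    using le[OF that] vm[OF that] by (auto simp: \<eta>_def)
  \<comment> \<open>compare the two eigenvalue equations at \<open>i\<close> to bound the average of the defect over the successors\<close>
  have "lm * vp i \<le> lp * vp i" using lmp vp[OF \<open>i \<in> V\<close>] by simp
  also have "\<dots> = transfer (\<lambda>v. exp (t * f v)) vp i" using eigen_eq[OF p \<open>i \<in> V\<close>] by simp
  also have "\<dots> \<le> (\<Sum>v\<in>E `` {i}. exp (2 * t) * (exp (- t * f v) * (vm v * (1 - \<eta> v))))"
    unfolding transfer_def
  proof (rule sum_mono)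
    fix w assume "w \<in> E `` {i}"
    then have w: "w \<in> V" using succ_sub by blast
    have "t * f w \<le> 2 * t + (- t * f w)" using t f[OF w] by (simp add: mult_left_le)
    then have "exp (t * f w) \<le> exp (2 * t) * exp (- t * f w)"
      by (metis exp_add exp_le_cancel_iff)
    then show "exp (t * f w) * vp w \<le> exp (2 * t) * (exp (- t * f w) * (vm w * (1 - \<eta> w)))"
      using vp[OF w] \<eta>(2)[OF w]
      by (metis mult.assoc mult_right_mono less_imp_le)
  qed
  also have "\<dots> = exp (2 * t) * (transfer (\<lambda>v. exp (- t * f v)) vm i
                  - transfer (\<lambda>v. exp (- t * f v)) (\<lambda>v. vm v * \<eta> v) i)"
    by (simp add: transfer_def sum_distrib_left sum_subtractf algebra_simps)
  also have "transfer (\<lambda>v. exp (- t * f v)) vm i = lm * vm i" using eigen_eq[OF m \<open>i \<in> V\<close>] .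
  finally have "exp (- 2 * t) * (lm * vp i) \<le> exp (- 2 * t) * (exp (2 * t) * (lm * vm i
                  - transfer (\<lambda>v. exp (- t * f v)) (\<lambda>v. vm v * \<eta> v) i))"
    by (intro mult_left_mono) auto
  also have "\<dots> = lm * vm i - transfer (\<lambda>v. exp (- t * f v)) (\<lambda>v. vm v * \<eta> v) i"
    by (simp flip: mult.assoc exp_add)
  finally have 1: "transfer (\<lambda>v. exp (- t * f v)) (\<lambda>v. vm v * \<eta> v) i
      \<le> lm * vm i * (1 - exp (- 2 * t) * (1 - \<eta> i))"
    using \<eta>(2)[OF \<open>i \<in> V\<close>] by (simp add: algebra_simps)
  have "exp (- 2 * t) \<ge> 1 - 2 * t" using exp_ge_add_one_self[of "-2 * t"] by simp
  moreover have "exp (- 2 * t) * \<eta> i \<le> 1 * \<eta> i"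
    using t \<eta>(1)[OF \<open>i \<in> V\<close>] by (intro mult_right_mono) auto
  ultimately have "1 - exp (- 2 * t) * (1 - \<eta> i) \<le> 2 * t + \<eta> i"
    by (simp add: algebra_simps)
  then have 2: "lm * vm i * (1 - exp (- 2 * t) * (1 - \<eta> i)) \<le> lm * vm i * (2 * t + \<eta> i)"
    using lm_pos vm[OF \<open>i \<in> V\<close>] by (intro mult_left_mono) auto
  have "exp (- t) * (vm j * \<eta> j) \<le> exp (- t * f j) * (vm j * \<eta> j)"
    using am[OF \<open>j \<in> V\<close>] vm[OF \<open>j \<in> V\<close>] \<eta>(1)[OF \<open>j \<in> V\<close>] by (intro mult_right_mono) auto
  also have "\<dots> \<le> transfer (\<lambda>v. exp (- t * f v)) (\<lambda>v. vm v * \<eta> v) i"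
    using vm \<eta> ij by (intro transfer_edge_le) (auto intro!: mult_nonneg_nonneg dest: less_imp_le)
  also have "\<dots> \<le> lm * vm i * (2 * t + \<eta> i)" using 1 2 by linarith
  also have "\<dots> \<le> lm * ((lm * exp t) ^ card V * vm j) * (2 * t + \<eta> i)"
    using ratio[OF V(2,1)] lm_pos t \<eta>(1)[OF \<open>i \<in> V\<close>] by (intro mult_right_mono mult_left_mono) auto
  finally have "exp t * (exp (- t) * (vm j * \<eta> j))
      \<le> exp t * (lm * ((lm * exp t) ^ card V * vm j) * (2 * t + \<eta> i))"
    by (intro mult_left_mono) auto
  moreover have "exp t * (exp (- t) * (vm j * \<eta> j)) = vm j * \<eta> j"
    by (simp flip: mult.assoc exp_add)
  moreover have "exp t * (lm * ((lm * exp t) ^ card V * vm j) * (2 * t + \<eta> i)) =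
      vm j * (G * (2 * t + \<eta> i))"
    by (simp add: G_def)
  ultimately have "\<eta> j \<le> G * (2 * t + \<eta> i)"
    using vm[OF \<open>j \<in> V\<close>] by simp
  also have "\<dots> \<le> G * (2 * t + 2 * t * real k * G ^ k)"
    using hyp G by (intro mult_left_mono) (auto simp: \<eta>_def)
  also have "\<dots> \<le> G * (2 * t * G ^ k + 2 * t * real k * G ^ k)"
    using G t one_le_power[OF G, of k] by (intro mult_left_mono add_right_mono) (auto simp: mult_le_cancel_left1)
  also have "\<dots> = 2 * t * real (Suc k) * G ^ Suc k" by (simp add: algebra_simps)
  finally show "1 - vp j / vm j \<le> 2 * t * real (Suc k) * G ^ Suc k" by (simp add: \<eta>_def)
qed

text \<open>
  The geometric mean \<open>w\<close> of the two eigenvectors is a sub-eigenvector of the unweighted operator.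
  If \<open>a\<close> and \<open>b\<close> are the summands of the two eigenvalue equations, then
  \<open>sqrt (a / b)\<close> lies in \<open>[c0, c1]\<close>, and expanding
  \<open>(sqrt a - c0 sqrt b) (c1 sqrt b - sqrt a) \<ge> 0\<close> gives the Polya-Szego form of the reverse
  Cauchy-Schwarz inequality.
\<close>

lemma eigenvalue_product_le:
  assumes p: "eigen (\<lambda>v. exp (t * f v)) lp vp" and m: "eigen (\<lambda>v. exp (- t * f v)) lm vm"
    and z: "eigen (\<lambda>_. 1) l0 v0" and c: "0 < c0" "c0 \<le> c1"
    and lo: "\<And>v. v \<in> V \<Longrightarrow> c0\<^sup>2 * (exp (- t * f v) * vm v) \<le> exp (t * f v) * vp v"
    and hi: "\<And>v. v \<in> V \<Longrightarrow> exp (t * f v) * vp v \<le> c1\<^sup>2 * (exp (- t * f v) * vm v)"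
  shows "4 * c0 * c1 * (lp * lm) \<le> (c0 + c1)\<^sup>2 * l0\<^sup>2"
proof -
  note vp = eigen_pos[OF p] and vm = eigen_pos[OF m]
  have lp: "0 < lp" and lm: "0 < lm" and l0: "0 < l0"
    using eigenvalue_pos[OF _ p] eigenvalue_pos[OF _ m] eigenvalue_pos[OF _ z] by auto
  define w where "w v = sqrt (vp v * vm v)" for v
  have w_pos: "0 < w v" if "v \<in> V" for v using vp[OF that] vm[OF that] by (simp add: w_def)
  define \<theta> where "\<theta> = 2 * sqrt (c0 * c1 * (lp * lm)) / (c0 + c1)"
  have "\<theta> \<le> l0"
  proof (rule sub_eigenvalue_le[OF _ z w_pos])
    fix u assume u: "u \<in> V"
    have pointwise: "exp (t * f v) * vp v + c0 * c1 * (exp (- t * f v) * vm v) \<le> (c0 + c1) * w v"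
      if "v \<in> V" for v
    proof -
      define a where "a = exp (t * f v) * vp v"
      define b where "b = exp (- t * f v) * vm v"
      have ab: "0 < a" "0 < b" using vp[OF that] vm[OF that] by (auto simp: a_def b_def)
      have w_eq: "w v = sqrt a * sqrt b"
        by (simp add: w_def a_def b_def real_sqrt_mult exp_minus flip: real_sqrt_mult)
      have "sqrt (c0\<^sup>2 * b) \<le> sqrt a" "sqrt a \<le> sqrt (c1\<^sup>2 * b)"
        using lo[OF that] hi[OF that] by (auto simp: a_def b_def)
      then have "c0 * sqrt b \<le> sqrt a" "sqrt a \<le> c1 * sqrt b"
        using c by (auto simp: real_sqrt_mult)
      then have "0 \<le> (sqrt a - c0 * sqrt b) * (c1 * sqrt b - sqrt a)"
        by (intro mult_nonneg_nonneg) auto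
      also have "\<dots> = (c0 + c1) * (sqrt a * sqrt b) - (sqrt a)\<^sup>2 - c0 * c1 * (sqrt b)\<^sup>2"
        by (simp add: algebra_simps power2_eq_square)
      finally show ?thesis using ab w_eq by (simp add: a_def b_def)
    qed
    have "2 * sqrt (c0 * c1 * (lp * lm)) * w u = 2 * (sqrt (lp * vp u) * sqrt (c0 * c1 * (lm * vm u)))"
      by (simp add: w_def algebra_simps flip: real_sqrt_mult)
    also have "\<dots> \<le> (sqrt (lp * vp u))\<^sup>2 + (sqrt (c0 * c1 * (lm * vm u)))\<^sup>2"
      using sum_squares_bound[of "sqrt (lp * vp u)" "sqrt (c0 * c1 * (lm * vm u))"] by simp
    also have "\<dots> = lp * vp u + c0 * c1 * (lm * vm u)"
      using lp lm vp[OF u] vm[OF u] c by simp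
    also have "\<dots> = (\<Sum>v\<in>E `` {u}. exp (t * f v) * vp v + c0 * c1 * (exp (- t * f v) * vm v))"
      using eigen_eq[OF p u] eigen_eq[OF m u]
      by (simp add: transfer_def sum.distrib flip: sum_distrib_left)
    also have "\<dots> \<le> (\<Sum>v\<in>E `` {u}. (c0 + c1) * w v)"
      using pointwise succ_sub[of u] by (intro sum_mono) auto
    also have "\<dots> = (c0 + c1) * transfer (\<lambda>_. 1) w u"
      by (simp add: transfer_def sum_distrib_left)
    finally show "\<theta> * w u \<le> transfer (\<lambda>_. 1) w u"
      using c by (simp add: \<theta>_def pos_divide_le_eq mult.commute)
  qed simp
  then have "2 * sqrt (c0 * c1 * (lp * lm)) \<le> (c0 + c1) * l0"
    using c by (simp add: \<theta>_def pos_divide_le_eq mult.commute)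
  then have "(2 * sqrt (c0 * c1 * (lp * lm)))\<^sup>2 \<le> ((c0 + c1) * l0)\<^sup>2"
    using c lp lm by (intro power_mono) auto
  then show ?thesis using c lp lm by (simp add: power_mult_distrib)
qed

text \<open>
  Combines the two preceding lemmas with \<open>c0 = 1 - t D\<close> and \<open>c1 = exp t\<close>. The error is
  quadratic in \<open>t\<close> because the loss in the reverse Cauchy-Schwarz inequality is
  \<open>(c1 - c0)\<^sup>2 / (4 c0 c1)\<close>.
\<close>

lemma pressure_second_difference:
  fixes f :: "'v \<Rightarrow> real" and t :: real
  assumes f: "\<And>v. v \<in> V \<Longrightarrow> 0 \<le> f v" "\<And>v. v \<in> V \<Longrightarrow> f v \<le> 1"
    and t: "0 < t" "t * curvature (card V) \<le> 1"
    and p: "eigen (\<lambda>v. exp (t * f v)) lp vp" and m: "eigen (\<lambda>v. exp (- t * f v)) lm vm"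
    and z: "eigen (\<lambda>_. 1) l0 v0"
  shows "ln lp + ln lm \<le> 2 * ln l0 + curvature (card V) * t\<^sup>2"
proof -
  define n where "n = card V"
  have n: "1 \<le> n" using finite_V V_nonempty by (simp add: n_def Suc_le_eq card_gt_0_iff)
  then have n': "1 \<le> real n" by simp
  \<comment> \<open>the maximum principle needs a quotient with maximum \<open>1\<close>\<close>
  define s where "s = Max ((\<lambda>v. vp v / vm v) ` V)"
  have "s \<in> (\<lambda>v. vp v / vm v) ` V"
    unfolding s_def using finite_V V_nonempty by (intro Max_in) auto
  then obtain i0 where i0: "i0 \<in> V" "s = vp i0 / vm i0" by blast
  have s: "0 < s" using i0 eigen_pos[OF p] eigen_pos[OF m] by simp
  define up where "up v = vp v / s" for v
  have up: "eigen (\<lambda>v. exp (t * f v)) lp up"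
    using p s by (simp add: eigen_def up_def transfer_def flip: sum_divide_distrib)
  have up_le: "up v \<le> vm v" if "v \<in> V" for v
  proof -
    have "vp v / vm v \<le> s" unfolding s_def using finite_V that by simp
    then show ?thesis using s eigen_pos[OF m that] by (simp add: up_def field_simps)
  qed
  have up_i0: "up i0 = vm i0" using i0 eigen_pos[OF p \<open>i0 \<in> V\<close>] by (simp add: up_def)
  define D where "D = 6 * real n ^ (n\<^sup>2 + n + 1)"
  have D: "6 \<le> D" using one_le_power[OF n', of "n\<^sup>2 + n + 1"] unfolding D_def by linarith
  have curv: "curvature (card V) = 16 / 9 * D\<^sup>2"
  proof -
    have "2 * n\<^sup>2 + 2 * n + 2 = (n\<^sup>2 + n + 1) * 2" by simp
    then show ?thesis
      unfolding curvature_def D_def n_def[symmetric] power_mult_distrib by (simp only: power_mult) simp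
  qed
  have n_le_D: "real (n * (n + 1)) \<le> D"
  proof -
    have "n + 1 \<le> 2 * n" using n by simp
    then have "n * (n + 1) \<le> 2 * n\<^sup>2" by (simp add: power2_eq_square)
    then have "real (n * (n + 1)) \<le> 2 * real n ^ 2"
      by (metis of_nat_le_iff of_nat_mult of_nat_numeral of_nat_power)
    also have "real n ^ 2 \<le> real n ^ (n\<^sup>2 + n + 1)"
      using n n' by (intro power_increasing) auto
    finally have "real (n * (n + 1)) \<le> 2 * real n ^ (n\<^sup>2 + n + 1)" by simp
    also have "\<dots> \<le> 6 * real n ^ (n\<^sup>2 + n + 1)" by (intro mult_right_mono) auto
    finally show ?thesis by (simp only: D_def)
  qed
  have tD: "t * D \<le> 3 / 32"
  proof -
    have "D * 6 \<le> D * D" using D by (intro mult_left_mono) auto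
    then have "t * (16 / 9 * (D * 6)) \<le> t * (16 / 9 * (D * D))"
      using t D by (intro mult_left_mono) auto
    also have "\<dots> \<le> 1" using t curv by (simp add: power2_eq_square)
    finally show ?thesis by simp
  qed
  have small: "1 - up v / vm v \<le> t * D" if v: "v \<in> V" for v
  proof -
    define H where "H = lm * exp t"
    have "lm \<le> real n * 1"
      unfolding n_def using f t by (intro eigenvalue_le[OF _ _ m]) auto
    moreover have "0 \<le> lm" using eigenvalue_pos[OF _ m] by force
    ultimately have H: "0 \<le> H" "H \<le> n * exp t" by (auto simp: H_def)
    have "real (n * (n + 1)) * t \<le> D * t" using n_le_D t by (intro mult_right_mono) auto
    then have e1: "real (n * (n + 1)) * t \<le> 1" using tD by (simp add: mult.commute)
    have "(H ^ Suc n) ^ n = H ^ (n * (n + 1))" by (simp only: power_mult[symmetric] Suc_eq_plus1 mult.commute)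
    also have "\<dots> \<le> (n * exp t) ^ (n * (n + 1))" using H by (intro power_mono)
    also have "\<dots> = real n ^ (n * (n + 1)) * exp (real (n * (n + 1)) * t)"
      by (simp only: power_mult_distrib exp_of_nat_mult)
    also have "\<dots> \<le> real n ^ (n * (n + 1)) * 3"
    proof (rule mult_left_mono)
      have "exp (real (n * (n + 1)) * t) \<le> exp 1" using e1 by (simp only: exp_le_cancel_iff)
      then show "exp (real (n * (n + 1)) * t) \<le> 3" using exp_le by linarith
    qed simp
    finally have pw: "(H ^ Suc n) ^ n \<le> real n ^ (n * (n + 1)) * 3" .
    have "1 - up v / vm v \<le> 2 * t * card V * ((lm * exp t) ^ Suc (card V)) ^ card V"
      by (rule eigenvector_quotient_near_constant[OF f _ up m up_le i0(1) up_i0 v]) (use t in auto)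
    also have "\<dots> = 2 * t * n * (H ^ Suc n) ^ n" by (simp only: n_def H_def)
    also have "\<dots> \<le> 2 * t * n * (real n ^ (n * (n + 1)) * 3)"
      using pw t by (intro mult_left_mono) auto
    also have "\<dots> = t * D"
      by (simp add: D_def power_add power2_eq_square algebra_simps)
    finally show ?thesis .
  qed
  define c0 where "c0 = 1 - t * D"
  define c1 where "c1 = exp t"
  have tD_pos: "0 < t * D" using t D by simp
  have c0: "1 / 2 \<le> c0" "c0 \<le> 1" using tD tD_pos by (auto simp: c0_def)
  have c1: "1 \<le> c1" using t by (simp add: c1_def)
  have main: "4 * c0 * c1 * (lp * lm) \<le> (c0 + c1)\<^sup>2 * l0\<^sup>2"
  proof (rule eigenvalue_product_le[OF up m z])
    fix v assume v: "v \<in> V"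
    note vm = eigen_pos[OF m v]
    have "c0\<^sup>2 \<le> c0" using c0 by (simp add: power2_eq_square mult_left_le)
    then have "c0\<^sup>2 * vm v \<le> c0 * vm v" using vm by simp
    also have "\<dots> \<le> up v" using small[OF v] vm by (simp add: c0_def field_simps)
    finally have 1: "c0\<^sup>2 * vm v \<le> up v" .
    have tf: "0 \<le> t * f v" "t * f v \<le> t" using t f[OF v] by (auto simp: mult_left_le)
    have "c0\<^sup>2 * (exp (- t * f v) * vm v) = exp (- t * f v) * (c0\<^sup>2 * vm v)" by simp
    also have "\<dots> \<le> exp (t * f v) * up v"
      using 1 tf vm by (intro mult_mono) auto
    finally show "c0\<^sup>2 * (exp (- t * f v) * vm v) \<le> exp (t * f v) * up v" .
    have "exp (t * f v) \<le> c1\<^sup>2 * exp (- t * f v)"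
      using tf by (simp add: c1_def power2_eq_square flip: exp_add)
    then have "exp (t * f v) * up v \<le> c1\<^sup>2 * exp (- t * f v) * vm v"
      using up_le[OF v] eigen_pos[OF up v] by (intro mult_mono) auto
    then show "exp (t * f v) * up v \<le> c1\<^sup>2 * (exp (- t * f v) * vm v)" by simp
  qed (use c0 c1 in auto)
  have t_le: "t \<le> 1 / 2"
  proof -
    have "t * 6 \<le> t * D" using D t by (intro mult_left_mono) auto
    then show ?thesis using tD by simp
  qed
  have "exp t \<le> 1 + 2 * t"
    using exp_bound_lemma[of t] t t_le by simp
  moreover have "t * 6 \<le> t * D" using D t by (intro mult_left_mono) auto
  ultimately have diff: "0 \<le> c1 - c0" "c1 - c0 \<le> 4 / 3 * (t * D)"
    using c0 c1 tD_pos t unfolding c0_def c1_def by linarith+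
  have "(c0 + c1)\<^sup>2 = 4 * c0 * c1 + (c1 - c0)\<^sup>2" by (simp add: power2_eq_square algebra_simps)
  also have "\<dots> \<le> 4 * c0 * c1 + 16 / 9 * (t * D)\<^sup>2"
    using power_mono[OF diff(2,1), of 2] by (simp add: power_mult_distrib power_divide)
  also have "\<dots> = 4 * c0 * c1 + curvature (card V) * t\<^sup>2" by (simp add: curv power_mult_distrib)
  also have "\<dots> \<le> 4 * c0 * c1 + 4 * c0 * c1 * (curvature (card V) * t\<^sup>2)"
  proof -
    have "1 / 2 * 1 \<le> c0 * c1" using c0 c1 by (intro mult_mono) auto
    then have "1 * (curvature (card V) * t\<^sup>2) \<le> (4 * c0 * c1) * (curvature (card V) * t\<^sup>2)"
      by (intro mult_right_mono) (auto simp: curvature_def)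
    then show ?thesis by simp
  qed
  also have "\<dots> = 4 * c0 * c1 * (1 + curvature (card V) * t\<^sup>2)" by (simp add: algebra_simps)
  finally have "4 * c0 * c1 * (lp * lm) \<le> 4 * c0 * c1 * (1 + curvature (card V) * t\<^sup>2) * l0\<^sup>2"
    using main by (smt (verit) mult_right_mono zero_le_power2)
  then have prod: "lp * lm \<le> (1 + curvature (card V) * t\<^sup>2) * l0\<^sup>2"
    using c0 c1 by (simp add: mult.assoc)
  have pos: "0 < lp" "0 < lm" "0 < l0"
    using eigenvalue_pos[OF _ p] eigenvalue_pos[OF _ m] eigenvalue_pos[OF _ z] by auto
  have cpos: "0 \<le> curvature (card V) * t\<^sup>2" by (simp add: curvature_def)
  have "ln lp + ln lm = ln (lp * lm)" using pos by (simp add: ln_mult)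
  also have "\<dots> \<le> ln ((1 + curvature (card V) * t\<^sup>2) * l0\<^sup>2)" using pos prod cpos by (subst ln_le_cancel_iff) auto
  also have "\<dots> = ln (1 + curvature (card V) * t\<^sup>2) + 2 * ln l0"
    using pos cpos by (subst ln_mult) (auto simp: ln_realpow)
  also have "ln (1 + curvature (card V) * t\<^sup>2) \<le> curvature (card V) * t\<^sup>2" using cpos by (rule ln_add_one_self_le_self)
  finally show ?thesis by simp
qed

end

section \<open>Words of the SFT cover\<close>

definition win :: "(int \<Rightarrow> 'a) \<Rightarrow> int \<Rightarrow> nat \<Rightarrow> 'a list" where
  "win x i n = map (\<lambda>k. x (i + int k)) [0..<n]"

lemma length_win [simp]: "length (win x i n) = n"
  by (simp add: win_def)

lemma nth_win [simp]: "k < n \<Longrightarrow> win x i n ! k = x (i + int k)"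
  by (simp add: win_def)

lemma win_eq_iff: "win x i n = win y j n \<longleftrightarrow> (\<forall>k<n. x (i + int k) = y (j + int k))"
  by (auto simp: list_eq_iff_nth_eq)

lemma win_add: "win x i (a + b) = win x i a @ win x (i + int a) b"
  by (rule nth_equalityI) (auto simp: nth_append algebra_simps of_nat_diff)

lemma win_Suc: "win x i (Suc n) = win x i n @ [x (i + int n)]"
  by (simp add: win_def)

lemma take_win: "take a (win x i n) = win x i (min a n)"
  by (rule nth_equalityI) auto

lemma drop_win: "drop a (win x i n) = win x (i + int a) (n - a)"
  by (rule nth_equalityI) (auto simp: algebra_simps)

lemma tl_win: "tl (win x i n) = win x (i + 1) (n - 1)"
  by (rule nth_equalityI) (auto simp: nth_tl algebra_simps)

lemma butlast_win: "butlast (win x i n) = win x i (n - 1)"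
  by (rule nth_equalityI) (auto simp: nth_butlast)

lemma last_win: "1 \<le> n \<Longrightarrow> last (win x i n) = x (i + int n - 1)"
  by (subst last_conv_nth) (auto simp: of_nat_diff algebra_simps simp flip: length_0_conv)

lemma words_iff: "w \<in> words X n \<longleftrightarrow> (\<exists>x\<in>X. \<exists>i. w = win x i n)"
  by (auto simp: words_def occurs_in_def list_eq_iff_nth_eq) metis+

lemma win_in_words: "x \<in> X \<Longrightarrow> win x i n \<in> words X n"
  by (auto simp: words_iff)

lemma finite_words: "finite (words X n :: 'a::finite list set)"
proof (rule finite_subset)
  show "words X n \<subseteq> {w. set w \<subseteq> UNIV \<and> length w = n}" by (auto simp: words_def)
  show "finite {w :: 'a list. set w \<subseteq> UNIV \<and> length w = n}"
    by (rule finite_lists_length_eq) simp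
qed

lemma card_words_le: "card (words X n :: 'a::finite list set) \<le> CARD('a) ^ n"
proof -
  have "words X n \<subseteq> {w. set w \<subseteq> UNIV \<and> length w = n}" by (auto simp: words_def)
  then have "card (words X n) \<le> card {w :: 'a list. set w \<subseteq> UNIV \<and> length w = n}"
    by (intro card_mono finite_lists_length_eq) auto
  also have "\<dots> = CARD('a) ^ n" by (rule card_lists_length_eq) simp
  finally show ?thesis .
qed

text \<open>
  Every window of length \<open>k \<le> m\<close> is the initial part of a window of length \<open>m\<close>, which settles the
  forbidden words shorter than \<open>m\<close>.
\<close>

lemma SFT_cover_iff:
  assumes "1 \<le> m"
  shows "x \<in> SFT_cover X m \<longleftrightarrow> (\<forall>i. win x i m \<in> words X m)"
proof
  assume x: "x \<in> SFT_cover X m"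
  show "\<forall>i. win x i m \<in> words X m"
  proof (rule ccontr)
    assume "\<not> ?thesis"
    then obtain i where i: "win x i m \<notin> words X m" by blast
    then have "win x i m \<in> (\<Union>k\<in>{1..m}. {w. length w = k} - words X k)"
      using assms by auto
    moreover have "occurs_in (win x i m) x" by (auto simp: occurs_in_def)
    ultimately show False using x unfolding SFT_cover_def by blast
  qed
next
  assume x: "\<forall>i. win x i m \<in> words X m"
  show "x \<in> SFT_cover X m"
    unfolding SFT_cover_def
  proof (intro CollectI ballI notI)
    fix w assume w: "w \<in> (\<Union>k\<in>{1..m}. {w. length w = k} - words X k)" and "occurs_in w x"
    from \<open>occurs_in w x\<close> obtain i where "\<forall>k<length w. x (i + int k) = w ! k"
      unfolding occurs_in_def by blast
    then have i: "w = win x i (length w)" by (simp add: list_eq_iff_nth_eq)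
    have len: "length w \<le> m" using w by auto
    obtain y j where y: "y \<in> X" "win x i m = win y j m" using x words_iff by metis
    then have "w = win y j (length w)"
      using i len by (metis min.absorb1 take_win)
    then have "w \<in> words X (length w)" using y words_iff by blast
    then show False using w by auto
  qed
qed

lemma subset_SFT_cover: "1 \<le> m \<Longrightarrow> X \<subseteq> SFT_cover X m"
  by (auto simp: SFT_cover_iff win_in_words)

lemma SFT_cover_antimono:
  assumes "1 \<le> m" "m \<le> n"
  shows "SFT_cover X n \<subseteq> SFT_cover X m"
  using assms unfolding SFT_cover_def by force

text \<open>
  The Markov property of an \<open>m\<close>-step shift of finite type: a window of length \<open>m\<close> that meets both
  sides of the cut lies in the overlap of length \<open>m - 1\<close> as far as it has crossed the cut.
\<close>

lemma SFT_cover_glue: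
  assumes m: "1 \<le> m" and x: "x \<in> SFT_cover X m" and y: "y \<in> SFT_cover X m"
    and agree: "win x a (m - 1) = win y b (m - 1)"
  shows "(\<lambda>i. if i < a then x i else y (i - a + b)) \<in> SFT_cover X m" (is "?z \<in> _")
  unfolding SFT_cover_iff[OF m]
proof
  fix i
  show "win ?z i m \<in> words X m"
  proof (cases "i < a")
    case True
    have "?z (i + int k) = x (i + int k)" if "k < m" for k
    proof (cases "i + int k < a")
      case False
      define d where "d = nat (i + int k - a)"
      have d: "i + int k = a + int d" "d < m - 1" using False True that by (auto simp: d_def)
      then have "x (a + int d) = y (b + int d)" using agree by (simp add: win_eq_iff)
      then show ?thesis using d(1) False by (simp add: add.commute)
    qed simp
    then have "win ?z i m = win x i m" by (simp add: win_eq_iff)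
    then show ?thesis using x SFT_cover_iff[OF m] by metis
  next
    case False
    then have "win ?z i m = win y (i - a + b) m"
      by (simp add: win_eq_iff algebra_simps)
    then show ?thesis using y SFT_cover_iff[OF m] by metis
  qed
qed

text \<open>
  The words of length \<open>M\<close> serve as vertices of a graph whose paths are the longer words. Taking
  \<open>M\<close> larger than \<open>m\<close> is necessary when a pattern is longer than \<open>m\<close>.
\<close>

locale transitive_SFT =
  fixes X :: "(int \<Rightarrow> 'a :: {finite, discrete_topology}) set" and m M :: nat
  assumes m: "1 \<le> m" and mM: "m \<le> M" and X_nonempty: "X \<noteq> {}"
    and transitive: "topologically_transitive X"
begin

abbreviation "Y \<equiv> SFT_cover X m"

definition V :: "'a list set" where "V = words Y M"

definition E :: "('a list \<times> 'a list) set" where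
  "E = {(u, v). u \<in> V \<and> v \<in> V \<and> tl u = butlast v}"

lemma V_length: "u \<in> V \<Longrightarrow> length u = M"
  by (auto simp: V_def words_def)

lemma M_pos: "1 \<le> M" using m mM by simp

lemma win_edge: "x \<in> Y \<Longrightarrow> (win x i M, win x (i + 1) M) \<in> E"
  by (simp add: E_def V_def win_in_words tl_win butlast_win)

lemma win_trancl: "x \<in> Y \<Longrightarrow> (win x i M, win x (i + 1 + int d) M) \<in> E\<^sup>+"
proof (induction d)
  case 0
  then show ?case using win_edge by auto
next
  case (Suc d)
  have "(win x (i + 1 + int d) M, win x (i + 1 + int d + 1) M) \<in> E" using win_edge Suc by blast
  then show ?case using Suc by (simp add: algebra_simps trancl_into_trancl)
qed

text \<open>
  Transitivity of \<open>X\<close> joins the last \<open>m\<close> letters of \<open>u\<close> to the first \<open>m\<close> letters of \<open>v\<close> by a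
  word of \<open>X\<close>; gluing points that contain \<open>u\<close>, this word and \<open>v\<close> produces a point of the cover.
\<close>

lemma V_connected:
  assumes "u \<in> V" "v \<in> V"
  shows "(u, v) \<in> E\<^sup>+"
proof -
  obtain x i where x: "x \<in> Y" "u = win x i M" using assms by (auto simp: V_def words_iff)
  obtain y j where y: "y \<in> Y" "v = win y j M" using assms by (auto simp: V_def words_iff)
  define e where "e = i + int (M - m)"
  have "win x e m \<in> language X" "win y j m \<in> language X"
    using x y SFT_cover_iff[OF m] by (auto simp: language_def)
  then obtain c where "win x e m @ c @ win y j m \<in> language X"
    using transitive unfolding topologically_transitive_def by blast
  then obtain q p n where q: "q \<in> X" and qp: "win x e m @ c @ win y j m = win q p n"
    unfolding language_def words_iff by (auto simp: words_iff)
  then have "n = m + (length c + m)" by (metis length_append length_win)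
  with qp have "win x e m @ c @ win y j m = win q p (m + (length c + m))" by simp
  then have eq: "win x e m = win q p m" "win y j m = win q (p + int m + int (length c)) m"
    by (simp_all add: win_add append_eq_append_conv)
  have qY: "q \<in> Y" using q subset_SFT_cover[OF m] by blast
  define z1 where "z1 k = (if k < e then x k else q (k - e + p))" for k
  have "z1 \<in> Y"
    unfolding z1_def using SFT_cover_glue[OF m x(1) qY, of e p] eq(1)
    by (auto simp: win_eq_iff)
  \<comment> \<open>the position at which \<open>v\<close> is placed\<close>
  define e2 where "e2 = e + int m + int (length c)"
  have z1_q: "win z1 e (m + length c + m) = win q p (m + length c + m)"
    by (auto simp: win_eq_iff z1_def algebra_simps)
  have z1_y: "win z1 e2 m = win y j m"
    using eq(2) by (auto simp: win_eq_iff z1_def e2_def algebra_simps)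
  define z2 where "z2 k = (if k < e2 then z1 k else y (k - e2 + j))" for k
  have z2: "z2 \<in> Y"
    unfolding z2_def using SFT_cover_glue[OF m \<open>z1 \<in> Y\<close> y(1), of e2 j] z1_y
    by (auto simp: win_eq_iff)
  have "z2 (i + int k) = x (i + int k)" if k: "k < M" for k
  proof (cases "i + int k < e")
    case True
    then show ?thesis by (simp add: z2_def z1_def e2_def)
  next
    case False
    define d where "d = nat (i + int k - e)"
    have d: "i + int k = e + int d" "d < m" using False k mM by (auto simp: d_def e_def)
    have "x (e + int d) = q (p + int d)" using eq(1) d by (simp add: win_eq_iff)
    then show ?thesis using d by (simp add: z2_def z1_def e2_def algebra_simps)
  qed
  then have u: "win z2 i M = u" using x by (simp add: win_eq_iff)
  have v: "win z2 e2 M = v" using y by (auto simp: win_eq_iff z2_def algebra_simps)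
  have "e2 = i + 1 + int (M + length c - 1)"
    using M_pos mM by (simp add: e2_def e_def)
  then show ?thesis using win_trancl[OF z2, of i "M + length c - 1"] u v by simp
qed

sublocale strong_digraph V E
proof
  show "finite V" by (simp add: V_def finite_words)
  obtain x where "x \<in> X" using X_nonempty by blast
  then show "V \<noteq> {}" using win_in_words[of x Y 0 M] subset_SFT_cover[OF m] by (auto simp: V_def)
  show "E \<subseteq> V \<times> V" by (auto simp: E_def)
qed (rule V_connected)

text \<open>
  The first window is left out, so that a word of length \<open>M\<close> has sum \<open>0\<close> and each appended letter
  contributes exactly the weight of the vertex that it leads to.
\<close>

definition birkhoff :: "('a list \<Rightarrow> real) \<Rightarrow> 'a list \<Rightarrow> real" where
  "birkhoff f z = (\<Sum>i<length z - M. f (take M (drop (Suc i) z)))"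

text \<open>
  Every one-letter extension of a word corresponds to exactly one edge that leaves its last window.
  Surjectivity onto the admissible words is trivial; that all the extensions are admissible is the
  Markov property.
\<close>

lemma extension_bij:
  "bij_betw (\<lambda>(y, v). y @ [last v]) (SIGMA y:words Y (M + n). E `` {drop n y}) (words Y (M + Suc n))"
  unfolding bij_betw_def
proof
  show "inj_on (\<lambda>(y, v). y @ [last v]) (SIGMA y:words Y (M + n). E `` {drop n y})"
  proof (rule inj_onI, clarsimp)
    fix y v v' assume vv: "(drop n y, v) \<in> E" "(drop n y, v') \<in> E" "last v = last v'"
    then have "length v = M" "length v' = M" using V_length by (auto simp: E_def)
    then have "v \<noteq> []" "v' \<noteq> []" using M_pos by auto
    moreover have "butlast v = butlast v'" using vv by (simp add: E_def)
    ultimately show "v = v'" using vv(3) by (metis append_butlast_last_id)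
  qed
  show "(\<lambda>(y, v). y @ [last v]) ` (SIGMA y:words Y (M + n). E `` {drop n y}) = words Y (M + Suc n)"
  proof safe
    fix y v assume y: "y \<in> words Y (M + n)" and v: "(drop n y, v) \<in> E"
    obtain p i where p: "p \<in> Y" "y = win p i (M + n)" using y words_iff by blast
    obtain q j where q: "q \<in> Y" "v = win q j M" using v by (auto simp: E_def V_def words_iff)
    have vd: "tl (drop n y) = butlast v" using v by (simp add: E_def)
    have tl: "tl (drop n y) = win p (i + int n + 1) (M - 1)"
      using p by (simp add: drop_win tl_win)
    have bl: "butlast v = win q j (M - 1)"
      using q by (simp add: butlast_win)
    have agree: "win p (i + int n + 1) (M - 1) = win q j (M - 1)" using vd tl bl by simp
    define a where "a = i + int n + 1"
    define z where "z k = (if k < a then p k else q (k - a + j))" for k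
    have "z \<in> Y"
      unfolding z_def a_def
    proof (rule SFT_cover_glue[OF m p(1) q(1)])
      show "win p (i + int n + 1) (m - 1) = win q j (m - 1)"
        using agree mM unfolding win_eq_iff by (meson diff_le_mono less_le_trans)
    qed
    have "z (i + int k) = p (i + int k)" if "k < M + n" for k
    proof (cases "i + int k < a")
      case False
      define d where "d = nat (i + int k - a)"
      have d: "i + int k = a + int d" "d < M - 1" using False that by (auto simp: d_def a_def)
      have "p (i + int n + 1 + int d) = q (j + int d)" using agree d(2) by (simp only: win_eq_iff)
      then show ?thesis unfolding z_def d(1) by (simp add: a_def algebra_simps)
    qed (simp add: z_def)
    then have "win z i (M + n) = y" using p by (simp add: win_eq_iff)
    moreover have "z (i + int (M + n)) = last v"
      unfolding q(2) last_win[OF M_pos] using M_pos by (simp add: z_def a_def algebra_simps)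
    ultimately have "y @ [last v] = win z i (M + Suc n)"
      by (simp add: win_Suc)
    then show "y @ [last v] \<in> words Y (M + Suc n)" using \<open>z \<in> Y\<close> words_iff by blast
  next
    fix w assume "w \<in> words Y (M + Suc n)"
    then obtain z i where z: "z \<in> Y" "w = win z i (M + Suc n)" using words_iff by blast
    define y where "y = win z i (M + n)"
    define v where "v = win z (i + int n + 1) M"
    have "drop n y = win z (i + int n) M" by (simp add: y_def drop_win)
    then have "(drop n y, v) \<in> E" using win_edge[OF z(1), of "i + int n"] by (simp add: v_def)
    moreover have "y \<in> words Y (M + n)" using z y_def win_in_words by blast
    moreover have "w = y @ [last v]"
      unfolding z(2) y_def v_def last_win[OF M_pos] by (simp add: win_Suc algebra_simps)
    ultimately show "w \<in> (\<lambda>(y, v). y @ [last v]) ` (SIGMA y:words Y (M + n). E `` {drop n y})"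
      by force
  qed
qed

lemma sum_words_Suc:
  "(\<Sum>z\<in>words Y (M + Suc n). F z) = (\<Sum>y\<in>words Y (M + n). \<Sum>v\<in>E `` {drop n y}. F (y @ [last v]) :: real)"
proof -
  have "(\<Sum>z\<in>words Y (M + Suc n). F z) = (\<Sum>(y, v)\<in>(SIGMA y:words Y (M + n). E `` {drop n y}). F (y @ [last v]))"
    using sum.reindex_bij_betw[OF extension_bij, of F n] by (simp add: case_prod_unfold)
  also have "\<dots> = (\<Sum>y\<in>words Y (M + n). \<Sum>v\<in>E `` {drop n y}. F (y @ [last v]))"
    by (rule sum.Sigma[symmetric]) (auto simp: finite_words finite_succ)
  finally show ?thesis .
qed

lemma extension_suffix:
  assumes "y \<in> words Y (M + n)" "v \<in> E `` {drop n y}"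
  shows "drop (Suc n) (y @ [last v]) = v"
proof -
  have len: "length y = M + n" using assms by (auto simp: words_def)
  have v: "v \<in> V" "tl (drop n y) = butlast v" using assms by (auto simp: E_def)
  then have "v \<noteq> []" using V_length M_pos by fastforce
  have "drop (Suc n) (y @ [last v]) = tl (drop n y) @ [last v]"
    using len M_pos by (simp add: drop_Suc tl_drop)
  then show ?thesis using v \<open>v \<noteq> []\<close> by simp
qed

lemma birkhoff_extension:
  assumes "y \<in> words Y (M + n)" "v \<in> E `` {drop n y}"
  shows "birkhoff f (y @ [last v]) = birkhoff f y + f v"
proof -
  have len: "length y = M + n" using assms by (auto simp: words_def)
  have v: "length v = M" using assms V_length by (auto simp: E_def)
  have "birkhoff f (y @ [last v]) = (\<Sum>i<n. f (take M (drop (Suc i) (y @ [last v]))))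
      + f (take M (drop (Suc n) (y @ [last v])))"
    using len by (simp add: birkhoff_def)
  also have "(\<Sum>i<n. f (take M (drop (Suc i) (y @ [last v])))) = birkhoff f y"
    using len by (auto simp: birkhoff_def intro!: sum.cong)
  also have "take M (drop (Suc n) (y @ [last v])) = v"
    using extension_suffix[OF assms] v by simp
  finally show ?thesis .
qed

lemma drop_in_V: "z \<in> words Y (M + n) \<Longrightarrow> drop n z \<in> V"
  unfolding V_def words_iff by (auto simp: drop_win) blast

text \<open>
  Weighting each word with the eigenvector entry of its last window turns the recursion over word
  length into multiplication by the eigenvalue.
\<close>

lemma partition_function_eigen:
  assumes "eigen (\<lambda>v. exp (t * f v)) l r"
  shows "(\<Sum>z\<in>words Y (M + n). exp (t * birkhoff f z) * r (drop n z)) = l ^ n * (\<Sum>v\<in>V. r v)"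
proof (induction n)
  case 0
  have "birkhoff f z = 0" if "z \<in> words Y M" for z
    using that by (auto simp: birkhoff_def words_def)
  then show ?case by (simp add: V_def)
next
  case (Suc n)
  have "(\<Sum>z\<in>words Y (M + Suc n). exp (t * birkhoff f z) * r (drop (Suc n) z)) =
      (\<Sum>y\<in>words Y (M + n). \<Sum>v\<in>E `` {drop n y}. exp (t * birkhoff f (y @ [last v])) * r (drop (Suc n) (y @ [last v])))"
    by (rule sum_words_Suc)
  also have "\<dots> = (\<Sum>y\<in>words Y (M + n). exp (t * birkhoff f y) * transfer (\<lambda>v. exp (t * f v)) r (drop n y))"
    unfolding transfer_def sum_distrib_left
    by (intro sum.cong refl)
      (simp only: extension_suffix birkhoff_extension distrib_left exp_add mult.assoc)
  also have "\<dots> = (\<Sum>y\<in>words Y (M + n). l * (exp (t * birkhoff f y) * r (drop n y)))"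
  proof (intro sum.cong refl)
    fix y assume "y \<in> words Y (M + n)"
    then have "drop n y \<in> V" by (rule drop_in_V)
    then show "exp (t * birkhoff f y) * transfer (\<lambda>v. exp (t * f v)) r (drop n y)
        = l * (exp (t * birkhoff f y) * r (drop n y))"
      using eigen_eq[OF assms] by simp
  qed
  also have "\<dots> = l ^ Suc n * (\<Sum>v\<in>V. r v)"
    using Suc by (simp flip: sum_distrib_left)
  finally show ?case .
qed

lemma partition_function_bounds:
  assumes r: "eigen (\<lambda>v. exp (t * f v)) l r"
  shows "\<exists>B. \<forall>n. \<bar>ln (\<Sum>z\<in>words Y (M + n). exp (t * birkhoff f z)) - n * ln l\<bar> \<le> B"
proof -
  define a where "a = Min (r ` V)"
  define b where "b = Max (r ` V)"
  have "a \<in> r ` V" unfolding a_def using finite_V V_nonempty by (intro Min_in) auto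
  then have a: "0 < a" using eigen_pos[OF r] by auto
  have ab: "a \<le> r v" "r v \<le> b" if "v \<in> V" for v
    using that finite_V by (auto simp: a_def b_def)
  have b: "0 < b" using ab V_nonempty a by force
  have l: "0 < l" using eigenvalue_pos[OF _ r] by simp
  define s where "s = (\<Sum>v\<in>V. r v)"
  have s: "0 < s" unfolding s_def using eigen_pos[OF r] finite_V V_nonempty by (intro sum_pos)
  have "\<bar>ln (\<Sum>z\<in>words Y (M + n). exp (t * birkhoff f z)) - n * ln l\<bar>
     \<le> \<bar>ln (s / a)\<bar> + \<bar>ln (s / b)\<bar>" for n
  proof -
    define Z where "Z = (\<Sum>z\<in>words Y (M + n). exp (t * birkhoff f z))"
    have eq: "(\<Sum>z\<in>words Y (M + n). exp (t * birkhoff f z) * r (drop n z)) = l ^ n * s"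
      using partition_function_eigen[OF r] by (simp add: s_def)
    have "Z * a \<le> l ^ n * s"
      unfolding eq[symmetric] Z_def sum_distrib_right
      by (intro sum_mono mult_left_mono ab drop_in_V) auto
    then have up: "Z \<le> l ^ n * (s / a)" using a by (simp add: pos_le_divide_eq)
    have "l ^ n * s \<le> Z * b"
      unfolding eq[symmetric] Z_def sum_distrib_right
      by (intro sum_mono mult_left_mono ab drop_in_V) auto
    then have lo: "l ^ n * (s / b) \<le> Z" using b by (simp add: pos_divide_le_eq)
    have pos: "0 < l ^ n * (s / b)" using l s b by simp
    have "ln (l ^ n * (s / b)) \<le> ln Z" "ln Z \<le> ln (l ^ n * (s / a))"
      using lo up pos by (auto simp: ln_le_cancel_iff)
    moreover have "ln (l ^ n * x) = n * ln l + ln x" if "0 < x" for x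
      using l that by (simp add: ln_mult ln_realpow)
    ultimately show ?thesis using s a b unfolding Z_def[symmetric]
      by (smt (verit) divide_pos_pos)
  qed
  then show ?thesis by blast
qed

lemma count_words_bounds:
  assumes r: "eigen (\<lambda>_. 1) l r"
  shows "\<exists>B. \<forall>n\<ge>M. \<bar>ln (card (words Y n)) - n * ln l\<bar> \<le> B"
proof -
  have "eigen (\<lambda>v. exp (0 * (\<lambda>_. 0) v)) l r" using r by simp
  then obtain B where B: "\<And>n. \<bar>ln (\<Sum>z\<in>words Y (M + n). exp (0 * birkhoff (\<lambda>_. 0) z)) - n * ln l\<bar> \<le> B"
    using partition_function_bounds[of 0 "\<lambda>_. 0" l r] by metis
  have "\<bar>ln (card (words Y n)) - n * ln l\<bar> \<le> B + \<bar>M * ln l\<bar>" if "M \<le> n" for n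
  proof -
    have "\<bar>ln (card (words Y n)) - (n - M) * ln l\<bar> \<le> B"
      using B[of "n - M"] that by simp
    moreover have "(real n - real M) * ln l = n * ln l - M * ln l" by (simp add: algebra_simps)
    ultimately show ?thesis using that by (simp add: of_nat_diff)
  qed
  then show ?thesis by blast
qed

lemma h_top_eq_ln_eigenvalue:
  assumes r: "eigen (\<lambda>_. 1) l r"
  shows "h_top Y = ln l"
proof -
  obtain B where B: "\<And>n. n \<ge> M \<Longrightarrow> \<bar>ln (card (words Y n)) - n * ln l\<bar> \<le> B"
    using count_words_bounds[OF r] by blast
  have "(\<lambda>n. ln (card (words Y n)) / n - ln l) \<longlonglongrightarrow> 0"
  proof (rule Lim_null_comparison)
    show "\<forall>\<^sub>F n in sequentially. norm (ln (card (words Y n)) / n - ln l) \<le> B / n"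
      using eventually_ge_at_top[of M]
    proof eventually_elim
      case (elim n)
      have n: "0 < real n" using elim M_pos by simp
      then have "ln (card (words Y n)) / n - ln l = (ln (card (words Y n)) - n * ln l) / n"
        by (simp add: field_simps)
      then show ?case using B[OF elim] n by (simp add: abs_divide divide_right_mono)
    qed
    show "(\<lambda>n. B / real n) \<longlonglongrightarrow> 0" by (rule lim_const_over_n)
  qed
  then have "(\<lambda>n. ln (card (words Y n)) / n) \<longlonglongrightarrow> ln l" by (simp add: LIM_zero_iff)
  then show ?thesis unfolding h_top_def by (rule limI)
qed

text \<open>
  Word counts agree with \<open>exp (n h)\<close> up to a constant factor, which is much stronger than the
  definition of \<open>h_top\<close> as a limit. The same argument shows that the limit exists.
\<close>

lemma count_words_h_top: "\<exists>B. \<forall>n\<ge>M. \<bar>ln (card (words Y n)) - n * h_top Y\<bar> \<le> B"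
proof -
  obtain l r where "eigen (\<lambda>_. 1) l r" using perron_eigenvector[of "\<lambda>_. 1"] by auto
  then show ?thesis using count_words_bounds h_top_eq_ln_eigenvalue by metis
qed

end

section \<open>Averages over large sets of words\<close>

text \<open>
  Jensen's inequality for the exponential function, obtained from its tangent line at the
  logarithm of the mean.
\<close>

lemma sum_le_log_sum_exp:
  fixes a :: "'i \<Rightarrow> real"
  assumes "finite I" "I \<noteq> {}" "(\<Sum>y\<in>I. exp (a y)) \<le> W"
  shows "(\<Sum>y\<in>I. a y) \<le> card I * (ln W - ln (card I))"
proof -
  have I: "0 < real (card I)" using assms by (simp add: card_gt_0_iff)
  have "0 < (\<Sum>y\<in>I. exp (a y))" using assms by (intro sum_pos) auto
  then have W: "0 < W" using assms by linarith
  define c where "c = ln W - ln (card I)"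
  have ec: "exp (- c) = card I / W"
    using W I by (simp add: c_def exp_diff)
  have "(\<Sum>y\<in>I. a y - c) \<le> (\<Sum>y\<in>I. exp (a y - c) - 1)"
    by (intro sum_mono) (use exp_ge_add_one_self in \<open>smt (verit)\<close>)
  also have "\<dots> = (\<Sum>y\<in>I. exp (a y)) * exp (- c) - card I"
    by (simp add: sum_subtractf sum_distrib_right exp_diff exp_minus divide_inverse)
  also have "\<dots> \<le> W * exp (- c) - card I"
    using assms by (intro diff_right_mono mult_right_mono) auto
  also have "\<dots> = 0" using W by (simp add: ec)
  finally show ?thesis by (simp add: sum_subtractf c_def)
qed

context transitive_SFT
begin

text \<open>
  Both means are bounded by Jensen's inequality, one with the parameter \<open>t\<close> and one with \<open>- t\<close>, where
  the sum of exponentials over the given words is at most that over all words. Their difference only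
  sees the sum of the two pressures. The bound is useful when \<open>ln (card I)\<close> is close to
  \<open>n * h_top Y\<close>.
\<close>

lemma birkhoff_sums_close:
  fixes f :: "'a list \<Rightarrow> real" and t :: real
  assumes f: "\<And>v. v \<in> V \<Longrightarrow> 0 \<le> f v" "\<And>v. v \<in> V \<Longrightarrow> f v \<le> 1"
    and t: "0 < t" "t * curvature (card V) \<le> 1"
  shows "\<exists>B. \<forall>n (I :: 'i set) z1 z2. finite I \<longrightarrow> I \<noteq> {} \<longrightarrow> inj_on z1 I \<longrightarrow> inj_on z2 I \<longrightarrow>
      z1 ` I \<subseteq> words Y (M + n) \<longrightarrow> z2 ` I \<subseteq> words Y (M + n) \<longrightarrow>
      t * ((\<Sum>y\<in>I. birkhoff f (z1 y)) - (\<Sum>y\<in>I. birkhoff f (z2 y)))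
        \<le> card I * (n * (2 * h_top Y + curvature (card V) * t\<^sup>2) + B - 2 * ln (card I))"
proof -
  obtain lp vp where p: "eigen (\<lambda>v. exp (t * f v)) lp vp"
    using perron_eigenvector[of "\<lambda>v. exp (t * f v)"] by auto
  obtain lm vm where m: "eigen (\<lambda>v. exp (- t * f v)) lm vm"
    using perron_eigenvector[of "\<lambda>v. exp (- t * f v)"] by auto
  obtain l0 v0 where z: "eigen (\<lambda>_. 1) l0 v0" using perron_eigenvector[of "\<lambda>_. 1"] by auto
  have press: "ln lp + ln lm \<le> 2 * h_top Y + curvature (card V) * t\<^sup>2"
    using pressure_second_difference[OF f t p m z] h_top_eq_ln_eigenvalue[OF z] by simp
  define Z where "Z s n = (\<Sum>z\<in>words Y (M + n). exp (s * birkhoff f z))" for s n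
  obtain B1 where B1: "\<And>n. \<bar>ln (Z t n) - n * ln lp\<bar> \<le> B1"
    using partition_function_bounds[OF p] unfolding Z_def by blast
  obtain B2 where B2: "\<And>n. \<bar>ln (Z (- t) n) - n * ln lm\<bar> \<le> B2"
    using partition_function_bounds[OF m] unfolding Z_def by blast
  have one_sided: "(\<Sum>y\<in>I. s * birkhoff f (z y)) \<le> card I * (ln (Z s n) - ln (card I))"
    if "finite I" "I \<noteq> {}" "inj_on z I" "z ` I \<subseteq> words Y (M + n)" for I :: "'i set" and z n s
  proof (rule sum_le_log_sum_exp[OF that(1,2)])
    have "(\<Sum>y\<in>I. exp (s * birkhoff f (z y))) = (\<Sum>w\<in>z ` I. exp (s * birkhoff f w))"
      using that by (simp add: sum.reindex)
    also have "\<dots> \<le> Z s n"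
      unfolding Z_def using that by (intro sum_mono2 finite_words) auto
    finally show "(\<Sum>y\<in>I. exp (s * birkhoff f (z y))) \<le> Z s n" .
  qed
  show ?thesis
  proof (intro exI[of _ "B1 + B2"] allI impI)
    fix n and I :: "'i set" and z1 z2
    assume I: "finite I" "I \<noteq> {}" and inj: "inj_on z1 I" "inj_on z2 I"
      and sub: "z1 ` I \<subseteq> words Y (M + n)" "z2 ` I \<subseteq> words Y (M + n)"
    have "t * ((\<Sum>y\<in>I. birkhoff f (z1 y)) - (\<Sum>y\<in>I. birkhoff f (z2 y)))
        = (\<Sum>y\<in>I. t * birkhoff f (z1 y)) + (\<Sum>y\<in>I. - t * birkhoff f (z2 y))"
      by (simp add: sum_distrib_left right_diff_distrib sum_negf)
    also have "\<dots> \<le> card I * (ln (Z t n) - ln (card I)) + card I * (ln (Z (- t) n) - ln (card I))"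
      using one_sided[OF I inj(1) sub(1)] one_sided[OF I inj(2) sub(2)] by (intro add_mono)
    also have "\<dots> = card I * (ln (Z t n) + ln (Z (- t) n) - 2 * ln (card I))"
      by (simp add: algebra_simps)
    also have "\<dots> \<le> card I * (n * (2 * h_top Y + curvature (card V) * t\<^sup>2) + (B1 + B2) - 2 * ln (card I))"
    proof (intro mult_left_mono)
      have "n * (ln lp + ln lm) \<le> n * (2 * h_top Y + curvature (card V) * t\<^sup>2)"
        using press by (intro mult_left_mono) auto
      moreover have "n * (ln lp + ln lm) = n * ln lp + n * ln lm" by (simp add: algebra_simps)
      ultimately show "ln (Z t n) + ln (Z (- t) n) - 2 * ln (card I)
        \<le> n * (2 * h_top Y + curvature (card V) * t\<^sup>2) + (B1 + B2) - 2 * ln (card I)"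
        using B1[of n] B2[of n] by linarith
    qed simp
    finally show "t * ((\<Sum>y\<in>I. birkhoff f (z1 y)) - (\<Sum>y\<in>I. birkhoff f (z2 y)))
        \<le> card I * (n * (2 * h_top Y + curvature (card V) * t\<^sup>2) + (B1 + B2) - 2 * ln (card I))" .
  qed
qed

end

section \<open>Automorphisms as block codes\<close>

definition translate :: "int \<Rightarrow> (int \<Rightarrow> 'a) \<Rightarrow> (int \<Rightarrow> 'a)" where
  "translate i x = (\<lambda>k. x (k + i))"

lemma translate_apply [simp]: "translate i x k = x (k + i)"
  by (simp add: translate_def)

lemma shift_eq_translate: "shift x = translate 1 x"
  by (simp add: shift_def translate_def)

lemma translate_translate: "translate i (translate j x) = translate (i + j) x"
  by (simp add: translate_def algebra_simps)

lemma translate_0 [simp]: "translate 0 x = x"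
  by (simp add: translate_def)

lemma subshift_translate:
  assumes X: "subshift X" and x: "x \<in> X"
  shows "translate i x \<in> X"
proof -
  have inv: "shift ` X = X" using X by (simp add: subshift_def)
  have fwd: "translate 1 y \<in> X" if "y \<in> X" for y
    using inv that by (auto simp: shift_eq_translate[symmetric])
  have bwd: "translate (- 1) y \<in> X" if y: "y \<in> X" for y
  proof -
    obtain z where z: "z \<in> X" "y = shift z" using inv y by blast
    then have "translate (- 1) y = z" by (simp add: shift_eq_translate translate_translate)
    then show ?thesis using z by simp
  qed
  show ?thesis
  proof (induction i rule: int_induct[where k = 0])
    case (step1 i)
    have "translate (1 + i) x \<in> X" using fwd[OF step1(2)] by (simp only: translate_translate)
    then show ?case by (simp only: add.commute)
  next
    case (step2 i)
    have "translate (- 1 + i) x \<in> X" using bwd[OF step2(2)] by (simp only: translate_translate)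
    then show ?case by (simp only: uminus_add_conv_diff)
  qed (use x in simp)
qed

lemma compact_full_shift: "compact (UNIV :: (int \<Rightarrow> 'a :: {finite, discrete_topology}) set)"
  using compact_pointwise_box[of "\<lambda>_. UNIV :: 'a set"] by (simp add: finite_imp_compact)

lemma open_cylinder: "open {y :: int \<Rightarrow> 'a :: discrete_topology. \<forall>k\<in>{a..b}. y k = x k}"
proof -
  have "open {y. \<forall>k\<in>{a..b}. y k \<in> {x k}}"
    by (rule product_topology_basis') (simp_all add: discrete_topology_class.open_discrete)
  then show ?thesis by simp
qed

lemma open_contains_cylinder:
  fixes A :: "(int \<Rightarrow> 'a :: discrete_topology) set"
  assumes "open A" "x \<in> A"
  shows "\<exists>R :: nat. \<forall>y. (\<forall>k\<in>{- int R..int R}. y k = x k) \<longrightarrow> y \<in> A"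
proof -
  have "openin (product_topology (\<lambda>i. euclidean) UNIV) A"
    using assms by (simp add: open_fun_def)
  then obtain U where U: "x \<in> (\<Pi>\<^sub>E i\<in>UNIV. U i)" "finite {i. U i \<noteq> (UNIV :: 'a set)}"
      "(\<Pi>\<^sub>E i\<in>UNIV. U i) \<subseteq> A"
    using product_topology_open_contains_basis[OF _ assms(2), of "\<lambda>i. euclidean" UNIV] by auto
  define R where "R = Max (insert 0 ((\<lambda>i. nat \<bar>i\<bar>) ` {i. U i \<noteq> UNIV}))"
  have R: "i \<in> {- int R..int R}" if "U i \<noteq> UNIV" for i
  proof -
    have "nat \<bar>i\<bar> \<le> R" unfolding R_def using that U(2) by (intro Max_ge) auto
    then show ?thesis by auto
  qed
  have "y \<in> A" if y: "\<forall>k\<in>{- int R..int R}. y k = x k" for y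
  proof -
    have "y i \<in> U i" for i
      using U(1) R[of i] y by (cases "U i = UNIV") (auto simp: PiE_iff)
    then show ?thesis using U(3) by (auto simp: PiE_iff)
  qed
  then show ?thesis by blast
qed

text \<open>
  Sets that depend only on the coordinates in \<open>[-R, R]\<close>; over a finite alphabet these are, as \<open>R\<close>
  varies, exactly the clopen sets.
\<close>

definition window_set :: "nat \<Rightarrow> (int \<Rightarrow> 'a) set \<Rightarrow> bool" where
  "window_set R C \<longleftrightarrow> (\<forall>x y. (\<forall>k\<in>{- int R..int R}. x k = y k) \<longrightarrow> x \<in> C \<longrightarrow> y \<in> C)"

lemma window_setD:
  assumes "window_set R C" "\<And>k. \<bar>k\<bar> \<le> int R \<Longrightarrow> x k = y k"
  shows "x \<in> C \<longleftrightarrow> y \<in> C"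
proof -
  have "\<forall>k\<in>{- int R..int R}. x k = y k" "\<forall>k\<in>{- int R..int R}. y k = x k"
    using assms(2) by auto
  then show ?thesis using assms(1) unfolding window_set_def by blast
qed

lemma window_set_mono:
  assumes "window_set R C" "R \<le> R'"
  shows "window_set R' C"
proof -
  have "{- int R..int R} \<subseteq> {- int R'..int R'}" using assms(2) by auto
  then show ?thesis using assms(1) unfolding window_set_def by blast
qed

definition block_code :: "nat \<Rightarrow> (int \<Rightarrow> 'a) set \<Rightarrow> ((int \<Rightarrow> 'a) \<Rightarrow> (int \<Rightarrow> 'a)) \<Rightarrow> bool" where
  "block_code R X \<phi> \<longleftrightarrow>
     (\<forall>x\<in>X. \<forall>y\<in>X. \<forall>i. (\<forall>k\<in>{i - int R..i + int R}. x k = y k) \<longrightarrow> \<phi> x i = \<phi> y i)"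

lemma block_code_mono:
  assumes "block_code R X \<phi>" "R \<le> R'"
  shows "block_code R' X \<phi>"
proof -
  have "{i - int R..i + int R} \<subseteq> {i - int R'..i + int R'}" for i using assms(2) by auto
  then show ?thesis using assms(1) unfolding block_code_def by blast
qed

lemma Aut_translate:
  assumes X: "subshift X" and \<phi>: "\<phi> \<in> Aut X" and x: "x \<in> X"
  shows "\<phi> (translate i x) = translate i (\<phi> x)"
proof -
  have comm: "\<phi> (translate 1 y) = translate 1 (\<phi> y)" if "y \<in> X" for y
    using \<phi> that by (simp add: Aut_def flip: shift_eq_translate)
  show ?thesis
  proof (induction i rule: int_induct[where k = 0])
    case (step1 i)
    have "\<phi> (translate (1 + i) x) = translate 1 (\<phi> (translate i x))"
      unfolding translate_translate[symmetric] by (intro comm subshift_translate[OF X x])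
    also have "\<dots> = translate (1 + i) (\<phi> x)"
      unfolding step1(2) translate_translate ..
    finally show ?case by (simp only: add.commute)
  next
    case (step2 i)
    have "translate 1 (\<phi> (translate (i - 1) x)) = \<phi> (translate 1 (translate (i - 1) x))"
      by (intro comm[symmetric] subshift_translate[OF X x])
    also have "translate 1 (translate (i - 1) x) = translate i x"
      by (simp add: translate_translate)
    also have "\<phi> \<dots> = translate i (\<phi> x)"
      by (rule step2(2))
    finally have "translate (- 1) (translate 1 (\<phi> (translate (i - 1) x))) = translate (- 1) (translate i (\<phi> x))"
      by (rule arg_cong)
    then have "\<phi> (translate (i - 1) x) = translate (i - 1) (\<phi> x)"
      by (simp add: translate_translate)
    then show ?case .
  qed simp
qed

text \<open>
  The theorem of Curtis, Hedlund and Lyndon: by continuity and compactness the coordinate at \<open>0\<close> of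
  \<open>\<phi> x\<close> depends on finitely many coordinates of \<open>x\<close>, and commutation with the shift transports this to
  all other coordinates.
\<close>

lemma Aut_block_code:
  fixes X :: "(int \<Rightarrow> 'a :: {finite, discrete_topology}) set"
  assumes X: "subshift X" and \<phi>: "\<phi> \<in> Aut X"
  shows "\<exists>R. block_code R X \<phi>"
proof -
  have cont: "continuous_on X \<phi>" using \<phi> by (auto simp: Aut_def homeomorphism_def)
  have "closed X" using X by (simp add: subshift_def)
  then have comp: "compact X" using compact_Int_closed[OF compact_full_shift] by simp
  have "\<exists>r :: nat. \<forall>y\<in>X. (\<forall>k\<in>{- int r..int r}. y k = x k) \<longrightarrow> \<phi> y 0 = \<phi> x 0" if x: "x \<in> X" for x
  proof -
    have "open {y :: int \<Rightarrow> 'a. y 0 = \<phi> x 0}"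
      using open_cylinder[of 0 0 "\<phi> x"] by simp
    moreover have "\<phi> x \<in> {y. y 0 = \<phi> x 0}" by simp
    ultimately obtain A where "open A" "x \<in> A" "\<forall>y\<in>X. y \<in> A \<longrightarrow> \<phi> y \<in> {y. y 0 = \<phi> x 0}"
      using cont x unfolding continuous_on_topological by blast
    then have A: "open A" "x \<in> A" "\<forall>y\<in>X. y \<in> A \<longrightarrow> \<phi> y 0 = \<phi> x 0" by auto
    then show ?thesis using open_contains_cylinder[OF A(1,2)] by blast
  qed
  then have "\<forall>x\<in>X. \<exists>r :: nat. \<forall>y\<in>X. (\<forall>k\<in>{- int r..int r}. y k = x k) \<longrightarrow> \<phi> y 0 = \<phi> x 0"
    by blast
  from bchoice[OF this] obtain r :: "(int \<Rightarrow> 'a) \<Rightarrow> nat" where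
    r: "\<And>x y. x \<in> X \<Longrightarrow> y \<in> X \<Longrightarrow> (\<forall>k\<in>{- int (r x)..int (r x)}. y k = x k) \<Longrightarrow> \<phi> y 0 = \<phi> x 0"
    by blast
  define U where "U x = {y. \<forall>k\<in>{- int (r x)..int (r x)}. y k = x k}" for x
  obtain T where T: "T \<subseteq> X" "finite T" "X \<subseteq> (\<Union>x\<in>T. U x)"
  proof (rule compactE_image[OF comp, of X U])
    show "open (U x)" for x unfolding U_def by (rule open_cylinder)
    show "X \<subseteq> (\<Union>x\<in>X. U x)" by (auto simp: U_def)
  qed auto
  define R where "R = Max (insert 0 (r ` T))"
  have R: "r z \<le> R" if "z \<in> T" for z unfolding R_def using that T(2) by (intro Max_ge) auto
  have zero: "\<phi> x 0 = \<phi> y 0" if xy: "x \<in> X" "y \<in> X" "\<forall>k\<in>{- int R..int R}. x k = y k" for x y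
  proof -
    obtain z where z: "z \<in> T" "x \<in> U z" using T xy by blast
    have "y \<in> U z" using z xy(3) R[OF z(1)] by (auto simp: U_def)
    have "z \<in> X" using z T by blast
    have "\<phi> x 0 = \<phi> z 0"
      by (rule r[OF \<open>z \<in> X\<close> xy(1)]) (use z(2) in \<open>simp add: U_def\<close>)
    moreover have "\<phi> y 0 = \<phi> z 0"
      by (rule r[OF \<open>z \<in> X\<close> xy(2)]) (use \<open>y \<in> U z\<close> in \<open>simp add: U_def\<close>)
    ultimately show ?thesis by simp
  qed
  have "block_code R X \<phi>"
    unfolding block_code_def
  proof (intro ballI allI impI)
    fix x y i assume xy: "x \<in> X" "y \<in> X" "\<forall>k\<in>{i - int R..i + int R}. x k = y k"
    have "\<phi> (translate i x) 0 = \<phi> (translate i y) 0"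
      using xy by (intro zero subshift_translate[OF X]) auto
    then show "\<phi> x i = \<phi> y i" using Aut_translate[OF X \<phi>] xy by simp
  qed
  then show ?thesis by blast
qed

lemma Aut_maps_to: "\<phi> \<in> Aut X \<Longrightarrow> x \<in> X \<Longrightarrow> \<phi> x \<in> X"
  by (auto simp: Aut_def homeomorphism_def)

lemma Aut_inverse:
  assumes X: "subshift X" and \<phi>: "\<phi> \<in> Aut X"
  shows "\<exists>\<psi>\<in>Aut X. \<forall>x\<in>X. \<psi> (\<phi> x) = x"
proof -
  obtain \<psi> where h: "homeomorphism X X \<phi> \<psi>" using \<phi> by (auto simp: Aut_def)
  then have inv: "\<psi> (\<phi> x) = x" if "x \<in> X" for x using that by (simp add: homeomorphism_def)
  have "\<psi> (shift y) = shift (\<psi> y)" if y: "y \<in> X" for y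
  proof -
    have "\<phi> ` X = X" using h by (simp add: homeomorphism_def)
    then obtain x where x: "x \<in> X" "y = \<phi> x" using y by blast
    have "shift x \<in> X" using subshift_translate[OF X x(1)] by (simp add: shift_eq_translate)
    moreover have "shift y = \<phi> (shift x)" using \<phi> x by (simp add: Aut_def)
    ultimately show ?thesis using inv x by simp
  qed
  then have "\<psi> \<in> Aut X" using h by (auto simp: Aut_def intro: homeomorphism_symD)
  then show ?thesis using inv by blast
qed

text \<open>
  The local rule of \<open>\<phi>\<close> applied to any sequence whose windows of length \<open>2 R + 1\<close> occur in \<open>X\<close>. The
  choice of the witness is immaterial for a block code of radius \<open>R\<close>; on sequences with other
  windows the value is arbitrary.
\<close>

definition extend_code ::
    "nat \<Rightarrow> (int \<Rightarrow> 'a) set \<Rightarrow> ((int \<Rightarrow> 'a) \<Rightarrow> (int \<Rightarrow> 'a)) \<Rightarrow> (int \<Rightarrow> 'a) \<Rightarrow> (int \<Rightarrow> 'a)" where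
  "extend_code R X \<phi> x i = \<phi> (SOME y. y \<in> X \<and> (\<forall>k\<in>{i - int R..i + int R}. y k = x k)) i"

lemma extend_code_eq:
  assumes "block_code R X \<phi>" "y \<in> X" "\<forall>k\<in>{i - int R..i + int R}. y k = x k"
  shows "extend_code R X \<phi> x i = \<phi> y i"
proof -
  define z where "z = (SOME y. y \<in> X \<and> (\<forall>k\<in>{i - int R..i + int R}. y k = x k))"
  have "z \<in> X \<and> (\<forall>k\<in>{i - int R..i + int R}. z k = x k)"
    unfolding z_def by (rule someI[of _ y]) (use assms in blast)
  then have "\<phi> z i = \<phi> y i" using assms unfolding block_code_def by (metis (full_types))
  then show ?thesis by (simp add: extend_code_def z_def)
qed

lemma SFT_cover_local:
  assumes X: "subshift X" and x: "x \<in> SFT_cover X N" and L: "1 \<le> N" "b \<le> a + int N - 1"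
  shows "\<exists>y\<in>X. \<forall>k\<in>{a..b}. y k = x k"
proof -
  have "win x a N \<in> words X N" using x SFT_cover_iff[OF L(1)] by blast
  then obtain z j where z: "z \<in> X" "win x a N = win z j N" using words_iff by blast
  have "translate (j - a) z k = x k" if "k \<in> {a..b}" for k
  proof -
    define d where "d = nat (k - a)"
    have d: "k = a + int d" "d < N" using that L by (auto simp: d_def)
    have "x (a + int d) = z (j + int d)" using z(2) d(2) by (simp only: win_eq_iff)
    then show ?thesis unfolding d(1) by (simp add: algebra_simps)
  qed
  then show ?thesis using subshift_translate[OF X z(1)] by blast
qed

text \<open>
  Two codes of radius \<open>R\<close> are applied in a row, which needs windows of length \<open>4 R + 1\<close>. The cover of
  order \<open>m + (4 R + 1)\<close> provides these, together with the windows of length \<open>m + 2 R\<close> that determine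
  the words of length \<open>m\<close> in the image.
\<close>

locale extended_automorphism =
  fixes X :: "(int \<Rightarrow> 'a :: {finite, discrete_topology}) set" and \<phi> \<psi> and R m :: nat
  assumes X: "subshift X" and \<phi>: "\<phi> \<in> Aut X" and inv: "\<And>x. x \<in> X \<Longrightarrow> \<psi> (\<phi> x) = x"
    and code: "block_code R X \<phi>" and code_inv: "block_code R X \<psi>" and m: "1 \<le> m"
begin

abbreviation "Z \<equiv> SFT_cover X (m + (4 * R + 1))"
abbreviation "\<Phi> \<equiv> extend_code R X \<phi>"

lemma local_witness:
  assumes "x \<in> Z" "b \<le> a + int (m + 4 * R)"
  shows "\<exists>y\<in>X. (\<forall>k\<in>{a..b}. y k = x k) \<and> (\<forall>k\<in>{a + int R..b - int R}. \<Phi> x k = \<phi> y k)"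
proof -
  obtain y where y: "y \<in> X" "\<forall>k\<in>{a..b}. y k = x k"
    using SFT_cover_local[OF X assms(1), of b a] assms(2) by auto
  have "\<Phi> x k = \<phi> y k" if "k \<in> {a + int R..b - int R}" for k
    using that y by (intro extend_code_eq[OF code]) auto
  then show ?thesis using y by blast
qed

lemma extension_in_SFT_cover:
  assumes "x \<in> Z"
  shows "\<Phi> x \<in> SFT_cover X m"
  unfolding SFT_cover_iff[OF m]
proof
  fix i
  obtain y where y: "y \<in> X" "\<forall>k\<in>{i..i + int m - 1}. \<Phi> x k = \<phi> y k"
    using local_witness[OF assms, of "i + int m - 1 + int R" "i - int R"] by auto
  then have "win (\<Phi> x) i m = win (\<phi> y) i m" by (auto simp: win_eq_iff)
  then show "win (\<Phi> x) i m \<in> words X m"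
    using Aut_maps_to[OF \<phi> y(1)] by (simp add: win_in_words)
qed

lemma extension_injective:
  assumes x: "x \<in> Z" "x' \<in> Z" and eq: "\<forall>k\<in>{i - int R..i + int R}. \<Phi> x k = \<Phi> x' k"
  shows "x i = x' i"
proof -
  obtain y where y: "y \<in> X" "\<forall>k\<in>{i - 2 * int R..i + 2 * int R}. y k = x k"
      "\<forall>k\<in>{i - int R..i + int R}. \<Phi> x k = \<phi> y k"
    using local_witness[OF x(1), of "i + 2 * int R" "i - 2 * int R"] by auto
  obtain y' where y': "y' \<in> X" "\<forall>k\<in>{i - 2 * int R..i + 2 * int R}. y' k = x' k"
      "\<forall>k\<in>{i - int R..i + int R}. \<Phi> x' k = \<phi> y' k"
    using local_witness[OF x(2), of "i + 2 * int R" "i - 2 * int R"] by auto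
  have "\<forall>k\<in>{i - int R..i + int R}. \<phi> y k = \<phi> y' k" using y y' eq by metis
  then have "\<psi> (\<phi> y) i = \<psi> (\<phi> y') i"
    using code_inv Aut_maps_to[OF \<phi>] y y' unfolding block_code_def by blast
  then show ?thesis using inv y y' by auto
qed

text \<open>
  The equivalence \<open>x \<in> D \<longleftrightarrow> \<phi> x \<in> C\<close> on \<open>X\<close> involves only a window of length \<open>4 R + 1\<close>, so it
  survives the passage from \<open>X\<close> to the cover.
\<close>

lemma extension_preimage:
  assumes x: "x \<in> Z" and C: "window_set R C" and D: "window_set R D"
    and CD: "\<And>x. x \<in> X \<Longrightarrow> x \<in> D \<longleftrightarrow> \<phi> x \<in> C"
  shows "translate i x \<in> D \<longleftrightarrow> translate i (\<Phi> x) \<in> C"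
proof -
  obtain y where y: "y \<in> X" "\<forall>k\<in>{i - 2 * int R..i + 2 * int R}. y k = x k"
      "\<forall>k\<in>{i - int R..i + int R}. \<Phi> x k = \<phi> y k"
    using local_witness[OF x(1), of "i + 2 * int R" "i - 2 * int R"] by auto
  have "translate i x \<in> D \<longleftrightarrow> translate i y \<in> D"
    by (rule window_setD[OF D]) (use y in \<open>auto simp: abs_le_iff\<close>)
  also have "\<dots> \<longleftrightarrow> translate i (\<phi> y) \<in> C"
    using CD[OF subshift_translate[OF X y(1)]] Aut_translate[OF X \<phi> y(1)] by simp
  also have "\<dots> \<longleftrightarrow> translate i (\<Phi> x) \<in> C"
    by (rule window_setD[OF C]) (use y in \<open>auto simp: abs_le_iff\<close>)
  finally show ?thesis .
qed

end

section \<open>Frequencies along an automorphism\<close>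

definition visits :: "nat \<Rightarrow> (int \<Rightarrow> 'a) set \<Rightarrow> (int \<Rightarrow> 'a) \<Rightarrow> real" where
  "visits n C x = (\<Sum>i<n. indicator C (translate (int i) x))"

context transitive_SFT
begin

text \<open>
  The window that is read at time \<open>i\<close> is \<open>[i - R, i - R + M)\<close>. The words start at \<open>- R - 1\<close>
  because Birkhoff sums skip the first window.
\<close>

lemma visits_close:
  fixes t :: real
  assumes C: "window_set R C" "2 * R + 1 \<le> M" and t: "0 < t" "t * curvature (card V) \<le> 1"
  shows "\<exists>B. \<forall>n (I :: 'i set) x1 x2. finite I \<longrightarrow> I \<noteq> {} \<longrightarrow> x1 ` I \<subseteq> Y \<longrightarrow> x2 ` I \<subseteq> Y \<longrightarrow>
      inj_on (\<lambda>y. win (x1 y) (- int R - 1) (M + n)) I \<longrightarrow>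
      inj_on (\<lambda>y. win (x2 y) (- int R - 1) (M + n)) I \<longrightarrow>
      t * ((\<Sum>y\<in>I. visits n C (x1 y)) - (\<Sum>y\<in>I. visits n C (x2 y)))
        \<le> card I * (n * (2 * h_top Y + curvature (card V) * t\<^sup>2) + B - 2 * ln (card I))"
proof -
  define f :: "'a list \<Rightarrow> real" where "f u = indicator C (\<lambda>k. u ! nat (k + int R))" for u
  have f: "0 \<le> f v" "f v \<le> 1" for v by (auto simp: f_def indicator_def)
  have visits: "visits n C x = birkhoff f (win x (- int R - 1) (M + n))" for x n
  proof -
    have "f (take M (drop (Suc i) (win x (- int R - 1) (M + n)))) = indicator C (translate (int i) x)"
      if i: "i < n" for i
    proof -
      have "take M (drop (Suc i) (win x (- int R - 1) (M + n))) = win x (int i - int R) M"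
        using i by (simp add: drop_win take_win)
      moreover have "(\<lambda>k. win x (int i - int R) M ! nat (k + int R)) \<in> C \<longleftrightarrow> translate (int i) x \<in> C"
      proof (rule window_setD[OF C(1)])
        fix k :: int assume k: "\<bar>k\<bar> \<le> int R"
        then have "nat (k + int R) < M" "int (nat (k + int R)) = k + int R" using C(2) by auto
        then show "win x (int i - int R) M ! nat (k + int R) = translate (int i) x k"
          by (simp add: algebra_simps)
      qed
      ultimately show ?thesis by (simp add: f_def indicator_def)
    qed
    then show ?thesis by (simp add: visits_def birkhoff_def)
  qed
  obtain B where B: "\<And>n (I :: 'i set) z1 z2. finite I \<Longrightarrow> I \<noteq> {} \<Longrightarrow> inj_on z1 I \<Longrightarrow> inj_on z2 I \<Longrightarrow>
      z1 ` I \<subseteq> words Y (M + n) \<Longrightarrow> z2 ` I \<subseteq> words Y (M + n) \<Longrightarrow>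
      t * ((\<Sum>y\<in>I. birkhoff f (z1 y)) - (\<Sum>y\<in>I. birkhoff f (z2 y)))
        \<le> card I * (n * (2 * h_top Y + curvature (card V) * t\<^sup>2) + B - 2 * ln (card I))"
    using birkhoff_sums_close[of f t] f t by metis
  show ?thesis
    unfolding visits
    by (intro exI[of _ B] allI impI B) (auto intro: win_in_words)
qed

end

context extended_automorphism
begin

lemma visits_extension:
  assumes "x \<in> Z" "window_set R C" "window_set R D" "\<And>x. x \<in> X \<Longrightarrow> x \<in> D \<longleftrightarrow> \<phi> x \<in> C"
  shows "visits n D x = visits n C (\<Phi> x)"
  unfolding visits_def
  by (intro sum.cong refl) (simp add: extension_preimage[OF assms] indicator_def)

lemma extension_window_inj:
  assumes x: "x \<in> Z" "x' \<in> Z"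
    and eq: "win (\<Phi> x) (- int R - 1) (M + n) = win (\<Phi> x') (- int R - 1) (M + n)" and M: "2 * R + 1 \<le> M"
  shows "win x 0 n = win x' 0 n"
proof -
  have "x (int k) = x' (int k)" if k: "k < n" for k
  proof (rule extension_injective[OF x], rule ballI)
    fix i assume i: "i \<in> {int k - int R..int k + int R}"
    define d where "d = nat (i + int R + 1)"
    have d: "i = - int R - 1 + int d" "d < M + n" using i k M by (auto simp: d_def)
    have "\<Phi> x (- int R - 1 + int d) = \<Phi> x' (- int R - 1 + int d)"
      using eq d(2) by (simp only: win_eq_iff)
    then show "\<Phi> x i = \<Phi> x' i" by (simp only: d(1))
  qed
  then show ?thesis by (simp add: win_eq_iff)
qed

lemma window_inj:
  assumes eq: "win x (- int R - 1) (M + n) = win x' (- int R - 1) (M + n)" and M: "2 * R + 1 \<le> M"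
  shows "win x 0 n = win x' 0 n"
proof -
  have "x (int k) = x' (int k)" if k: "k < n" for k
  proof -
    have "R + 1 + k < M + n" using k M by simp
    then have "x (- int R - 1 + int (R + 1 + k)) = x' (- int R - 1 + int (R + 1 + k))"
      using eq by (simp only: win_eq_iff)
    then show ?thesis by simp
  qed
  then show ?thesis by (simp add: win_eq_iff)
qed

text \<open>
  The points \<open>x w\<close> and their images are two families of points of the cover of order \<open>m\<close>. Both have
  pairwise different words on \<open>[- R - 1, n + M - R - 1)\<close>, for the images by injectivity of the
  extended code, and the visits to \<open>D\<close> along \<open>x w\<close> are the visits to \<open>C\<close> along its image.
\<close>

lemma frequencies_close:
  fixes t :: real and M :: nat
  assumes trans: "topologically_transitive X" and M: "m \<le> M" "2 * R + 1 \<le> M"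
    and C: "window_set R C" and D: "window_set R D" and CD: "\<And>x. x \<in> X \<Longrightarrow> x \<in> D \<longleftrightarrow> \<phi> x \<in> C"
    and t: "0 < t" "t * curvature (card (words (SFT_cover X m) M)) \<le> 1"
  shows "\<exists>B. \<forall>n\<ge>m + (4 * R + 1). \<forall>x. (\<forall>w\<in>words Z n. x w \<in> Z \<and> win (x w) 0 n = w) \<longrightarrow>
    t * \<bar>(\<Sum>w\<in>words Z n. visits n C (x w)) - (\<Sum>w\<in>words Z n. visits n D (x w))\<bar>
      \<le> card (words Z n) * (n * (2 * h_top (SFT_cover X m) - 2 * h_top Z
          + curvature (card (words (SFT_cover X m) M)) * t\<^sup>2) + B)"
proof -
  have X_ne: "X \<noteq> {}" using X by (simp add: subshift_def)
  interpret Y: transitive_SFT X m M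
    by unfold_locales (use m M X_ne trans in auto)
  interpret Z: transitive_SFT X "m + (4 * R + 1)" "m + (4 * R + 1)"
    by unfold_locales (use m X_ne trans in auto)
  have ZY: "Z \<subseteq> SFT_cover X m" by (rule SFT_cover_antimono[OF m]) simp
  obtain B1 where B1: "\<And>n (I :: 'a list set) x1 x2. finite I \<Longrightarrow> I \<noteq> {} \<Longrightarrow>
      x1 ` I \<subseteq> SFT_cover X m \<Longrightarrow> x2 ` I \<subseteq> SFT_cover X m \<Longrightarrow>
      inj_on (\<lambda>y. win (x1 y) (- int R - 1) (M + n)) I \<Longrightarrow>
      inj_on (\<lambda>y. win (x2 y) (- int R - 1) (M + n)) I \<Longrightarrow>
      t * ((\<Sum>y\<in>I. visits n C (x1 y)) - (\<Sum>y\<in>I. visits n C (x2 y)))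
        \<le> card I * (n * (2 * h_top (SFT_cover X m) + curvature (card Y.V) * t\<^sup>2) + B1 - 2 * ln (card I))"
    using Y.visits_close[OF C M(2), of t] t unfolding Y.V_def by metis
  obtain B2 where B2: "\<And>n. m + (4 * R + 1) \<le> n \<Longrightarrow> \<bar>ln (card (words Z n)) - n * h_top Z\<bar> \<le> B2"
    using Z.count_words_h_top by blast
  show ?thesis
  proof (intro exI[of _ "B1 + 2 * B2"] allI impI)
    fix n x assume n: "m + (4 * R + 1) \<le> n"
      and x: "\<forall>w\<in>words Z n. x w \<in> Z \<and> win (x w) 0 n = w"
    define I where "I = words Z n"
    have I: "finite I" "I \<noteq> {}"
    proof -
      obtain y where "y \<in> X" using X_ne by blast
      then have "y \<in> Z" using subset_SFT_cover[of "m + (4 * R + 1)" X] m by auto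
      then show "I \<noteq> {}" using win_in_words I_def by blast
      show "finite I" unfolding I_def by (rule finite_words)
    qed
    have xZ: "x w \<in> Z" "win (x w) 0 n = w" if "w \<in> I" for w using x that by (auto simp: I_def)
    have sub1: "x ` I \<subseteq> SFT_cover X m" using xZ ZY by blast
    have sub2: "(\<lambda>w. \<Phi> (x w)) ` I \<subseteq> SFT_cover X m" using xZ extension_in_SFT_cover by blast
    have inj1: "inj_on (\<lambda>w. win (x w) (- int R - 1) (M + n)) I"
    proof (rule inj_onI)
      fix w w' assume w: "w \<in> I" "w' \<in> I"
        and "win (x w) (- int R - 1) (M + n) = win (x w') (- int R - 1) (M + n)"
      then have "win (x w) 0 n = win (x w') 0 n" using window_inj M(2) by blast
      then show "w = w'" using xZ(2) w by simp
    qed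
    have inj2: "inj_on (\<lambda>w. win (\<Phi> (x w)) (- int R - 1) (M + n)) I"
    proof (rule inj_onI)
      fix w w' assume w: "w \<in> I" "w' \<in> I"
        and "win (\<Phi> (x w)) (- int R - 1) (M + n) = win (\<Phi> (x w')) (- int R - 1) (M + n)"
      then have "win (x w) 0 n = win (x w') 0 n" using extension_window_inj xZ(1) M(2) by blast
      then show "w = w'" using xZ(2) w by simp
    qed
    have vD: "(\<Sum>w\<in>I. visits n D (x w)) = (\<Sum>w\<in>I. visits n C (\<Phi> (x w)))"
      by (intro sum.cong refl visits_extension[OF xZ(1) C D CD])
    define bound where "bound = card I * (n * (2 * h_top (SFT_cover X m) + curvature (card Y.V) * t\<^sup>2) + B1 - 2 * ln (card I))"
    have le: "t * ((\<Sum>w\<in>I. visits n C (x w)) - (\<Sum>w\<in>I. visits n D (x w))) \<le> bound"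
       "t * ((\<Sum>w\<in>I. visits n D (x w)) - (\<Sum>w\<in>I. visits n C (x w))) \<le> bound"
      unfolding vD bound_def
      by (rule B1[OF I sub1 sub2 inj1 inj2], rule B1[OF I sub2 sub1 inj2 inj1])
    then have "t * \<bar>(\<Sum>w\<in>I. visits n C (x w)) - (\<Sum>w\<in>I. visits n D (x w))\<bar> \<le> bound"
      by (simp add: abs_if right_diff_distrib)
    also have "\<dots> \<le> card I * (n * (2 * h_top (SFT_cover X m) - 2 * h_top Z + curvature (card Y.V) * t\<^sup>2) + (B1 + 2 * B2))"
      unfolding bound_def
    proof (intro mult_left_mono)
      have "n * h_top Z - B2 \<le> ln (card I)" using B2[OF n] unfolding I_def by linarith
      moreover have "n * (2 * h_top (SFT_cover X m) - 2 * h_top Z + curvature (card Y.V) * t\<^sup>2)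
          = n * (2 * h_top (SFT_cover X m) + curvature (card Y.V) * t\<^sup>2) - 2 * (n * h_top Z)"
        by (simp add: algebra_simps)
      ultimately show "n * (2 * h_top (SFT_cover X m) + curvature (card Y.V) * t\<^sup>2) + B1 - 2 * ln (card I)
        \<le> n * (2 * h_top (SFT_cover X m) - 2 * h_top Z + curvature (card Y.V) * t\<^sup>2) + (B1 + 2 * B2)"
        by linarith
    qed simp
    finally show "t * \<bar>(\<Sum>w\<in>words Z n. visits n C (x w)) - (\<Sum>w\<in>words Z n. visits n D (x w))\<bar>
      \<le> card (words Z n) * (n * (2 * h_top (SFT_cover X m) - 2 * h_top Z
          + curvature (card (words (SFT_cover X m) M)) * t\<^sup>2) + (B1 + 2 * B2))"
      unfolding I_def Y.V_def .
  qed
qed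

end

section \<open>Comparison with the entropy stability constant\<close>

lemma curvature_mono:
  assumes "1 \<le> n" "n \<le> k"
  shows "curvature n \<le> curvature k"
proof -
  have "real n ^ (2 * n\<^sup>2 + 2 * n + 2) \<le> real k ^ (2 * n\<^sup>2 + 2 * n + 2)"
    using assms by (intro power_mono) auto
  also have "\<dots> \<le> real k ^ (2 * k\<^sup>2 + 2 * k + 2)"
    using assms by (intro power_increasing add_mono mult_left_mono power_mono) auto
  finally show ?thesis by (simp add: curvature_def)
qed

lemma curvature_ge_1: "1 \<le> n \<Longrightarrow> 1 \<le> curvature n"
  using one_le_power[of "real n" "2 * n\<^sup>2 + 2 * n + 2"] by (simp add: curvature_def)

text \<open>
  The denominator of \<open>\<xi>\<close> lies in \<open>(0, 1]\<close>, so already its numerator dominates.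
\<close>

lemma xi_bounds:
  assumes s: "1 \<le> s"
  shows "1 \<le> \<xi> s" "curvature s \<le> (\<xi> s)\<^sup>2"
proof -
  define b where "b = 1 - 1 / (4 * real s ^ (2 * s\<^sup>2))"
  define d where "d = 1 - b powr (1 / real (s\<^sup>2))"
  define N where "N = 30 * real s ^ (3 * (s\<^sup>2 + 1))"
  have s': "1 \<le> real s" using s by simp
  have "1 \<le> real s ^ (2 * s\<^sup>2)" using s' by (rule one_le_power)
  then have "0 < b" "b < 1" by (auto simp: b_def divide_simps)
  then have "b powr (1 / real (s\<^sup>2)) < 1 powr (1 / real (s\<^sup>2))"
    using s by (intro powr_less_mono2) auto
  moreover have "0 < b powr (1 / real (s\<^sup>2))" using \<open>0 < b\<close> by simp
  ultimately have d: "0 < d" "d \<le> 1" by (auto simp: d_def)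
  have N: "30 \<le> N" using one_le_power[OF s'] by (simp add: N_def)
  have "N * d \<le> N * 1" using d N by (intro mult_left_mono) auto
  then have "N \<le> N / d" using d by (simp add: pos_le_divide_eq)
  moreover have "\<xi> s = N / d" by (simp add: \<xi>_def N_def d_def b_def)
  ultimately have xi: "N \<le> \<xi> s" by simp
  then show "1 \<le> \<xi> s" using N by simp
  have "2 * s\<^sup>2 + 2 * s + 2 \<le> 3 * (s\<^sup>2 + 1) * 2"
  proof -
    have "s \<le> s\<^sup>2" using s by (simp add: power2_eq_square)
    then show ?thesis by simp
  qed
  then have "real s ^ (2 * s\<^sup>2 + 2 * s + 2) \<le> real s ^ (3 * (s\<^sup>2 + 1) * 2)"
    using s' by (intro power_increasing)
  then have "curvature s \<le> 900 * real s ^ (3 * (s\<^sup>2 + 1) * 2)"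
    unfolding curvature_def by (intro mult_mono) auto
  also have "\<dots> = N\<^sup>2" by (simp only: N_def power_mult_distrib power_mult) simp
  also have "\<dots> \<le> (\<xi> s)\<^sup>2" using xi N by (intro power_mono) auto
  finally show "curvature s \<le> (\<xi> s)\<^sup>2" .
qed

section \<open>Invariant contents\<close>

text \<open>
  The relation under which a characteristic measure on \<open>X\<close> must give \<open>C\<close> and \<open>D\<close> the same mass.
\<close>

definition corresponding :: "(int \<Rightarrow> 'a :: discrete_topology) set \<Rightarrow> (int \<Rightarrow> 'a) set \<Rightarrow> (int \<Rightarrow> 'a) set \<Rightarrow> bool" where
  "corresponding X C D \<longleftrightarrow> (\<exists>\<phi>\<in>Aut X. \<forall>x\<in>X. x \<in> D \<longleftrightarrow> \<phi> x \<in> C)"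

text \<open>
  Defined on all subsets, so that these functions form a closed subset of a power of \<open>[0, 1]\<close>.
\<close>

definition content :: "((int \<Rightarrow> 'a) set \<Rightarrow> real) \<Rightarrow> bool" where
  "content g \<longleftrightarrow> (\<forall>A. g A \<in> {0..1}) \<and> (\<forall>A B. A \<inter> B = {} \<longrightarrow> g (A \<union> B) = g A + g B)"

lemma frequency_content:
  fixes x :: "'w \<Rightarrow> int \<Rightarrow> 'a"
  assumes "finite I" "I \<noteq> {}" "0 < n"
  shows "content (\<lambda>C. (\<Sum>w\<in>I. visits n C (x w)) / (n * card I))"
  unfolding content_def
proof (intro conjI allI impI)
  have pos: "0 < real n * real (card I)" using assms by (simp add: card_gt_0_iff)
  fix A :: "(int \<Rightarrow> 'a) set"
  have "0 \<le> visits n A y" "visits n A y \<le> n" for y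
    unfolding visits_def
    using sum_bounded_above[of "{..<n}" "\<lambda>i. indicator A (translate (int i) y)" "1 :: real"]
    by (auto intro!: sum_nonneg simp: indicator_def)
  then have "0 \<le> (\<Sum>w\<in>I. visits n A (x w))" "(\<Sum>w\<in>I. visits n A (x w)) \<le> card I * real n"
    by (auto intro!: sum_nonneg sum_bounded_above)
  then show "(\<Sum>w\<in>I. visits n A (x w)) / (n * card I) \<in> {0..1}"
    using pos by (simp add: divide_le_eq mult.commute)
next
  fix A B :: "(int \<Rightarrow> 'a) set" assume "A \<inter> B = {}"
  then have "visits n (A \<union> B) y = visits n A y + visits n B y" for y
    unfolding visits_def sum.distrib[symmetric]
    by (intro sum.cong refl) (auto simp: indicator_def)
  then show "(\<Sum>w\<in>I. visits n (A \<union> B) (x w)) / (n * card I)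
      = (\<Sum>w\<in>I. visits n A (x w)) / (n * card I) + (\<Sum>w\<in>I. visits n B (x w)) / (n * card I)"
    by (simp add: sum.distrib add_divide_distrib)
qed

text \<open>
  The radius \<open>R\<close> is fixed first, from the finitely many automorphisms and sets. Entropy stability
  with \<open>l = 1\<close> and \<open>j = 4 R + 1\<close> then yields \<open>m\<close>, and the content is the empirical frequency of long
  words of the cover of order \<open>m + j\<close>. The graph has the words of length \<open>max m (2 R + 1)\<close> as
  vertices: if \<open>m\<close> is the larger, \<open>\<xi>\<close> controls the constant; otherwise their number is bounded in
  terms of \<open>R\<close> alone, and the constant \<open>K\<close> was put into \<open>\<epsilon>\<close> beforehand.
\<close>

lemma almost_invariant_content:
  fixes X :: "(int \<Rightarrow> 'a :: {finite, discrete_topology}) set"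
  assumes stable: "entropy_stable X" and P: "finite P" and \<epsilon>: "0 < \<epsilon>"
    and pairs: "\<And>C D. (C, D) \<in> P \<Longrightarrow> window_set R0 C \<and> window_set R0 D \<and> corresponding X C D"
  shows "\<exists>g. content g \<and> (\<forall>A. window_set R0 A \<and> X \<subseteq> A \<longrightarrow> g A = 1) \<and>
    (\<forall>(C, D)\<in>P. \<bar>g C - g D\<bar> \<le> \<epsilon>)"
proof -
  have X: "subshift X" and trans: "topologically_transitive X"
    using stable by (auto simp: entropy_stable_def)
  have X_ne: "X \<noteq> {}" using X by (simp add: subshift_def)
  have "\<forall>p\<in>P. \<exists>q. case q of (\<phi>, \<psi>, r) \<Rightarrow> \<phi> \<in> Aut X \<and> (\<forall>x\<in>X. x \<in> snd p \<longleftrightarrow> \<phi> x \<in> fst p) \<and>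
      (\<forall>x\<in>X. \<psi> (\<phi> x) = x) \<and> block_code r X \<phi> \<and> block_code r X \<psi>"
  proof
    fix p assume "p \<in> P"
    then obtain \<phi> where \<phi>: "\<phi> \<in> Aut X" "\<forall>x\<in>X. x \<in> snd p \<longleftrightarrow> \<phi> x \<in> fst p"
      using pairs[of "fst p" "snd p"] by (auto simp: corresponding_def)
    obtain \<psi> where \<psi>: "\<psi> \<in> Aut X" "\<forall>x\<in>X. \<psi> (\<phi> x) = x" using Aut_inverse[OF X \<phi>(1)] by blast
    obtain r1 where r1: "block_code r1 X \<phi>" using Aut_block_code[OF X \<phi>(1)] by blast
    obtain r2 where r2: "block_code r2 X \<psi>" using Aut_block_code[OF X \<psi>(1)] by blast
    have "block_code (max r1 r2) X \<phi>" "block_code (max r1 r2) X \<psi>"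
      using block_code_mono[OF r1, of "max r1 r2"] block_code_mono[OF r2, of "max r1 r2"] by auto
    then show "\<exists>q. case q of (\<phi>, \<psi>, r) \<Rightarrow> \<phi> \<in> Aut X \<and> (\<forall>x\<in>X. x \<in> snd p \<longleftrightarrow> \<phi> x \<in> fst p) \<and>
      (\<forall>x\<in>X. \<psi> (\<phi> x) = x) \<and> block_code r X \<phi> \<and> block_code r X \<psi>"
      using \<phi> \<psi> by (intro exI[of _ "(\<phi>, \<psi>, max r1 r2)"]) auto
  qed
  from bchoice[OF this] obtain q where q: "\<forall>p\<in>P. case q p of (\<phi>, \<psi>, r) \<Rightarrow> \<phi> \<in> Aut X \<and>
      (\<forall>x\<in>X. x \<in> snd p \<longleftrightarrow> \<phi> x \<in> fst p) \<and>
      (\<forall>x\<in>X. \<psi> (\<phi> x) = x) \<and> block_code r X \<phi> \<and> block_code r X \<psi>" by blast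
  define R where "R = Max (insert R0 ((\<lambda>p. snd (snd (q p))) ` P))"
  have R0: "R0 \<le> R" unfolding R_def using P by simp
  have Rq: "snd (snd (q p)) \<le> R" if "p \<in> P" for p
    unfolding R_def using P that by (intro Max_ge) auto
  have win_R: "window_set R C" "window_set R D" if "(C, D) \<in> P" for C D
    using pairs[OF that] window_set_mono R0 by blast+

  \<comment> \<open>\<open>K\<close> bounds the constant in the case \<open>m < 2 R + 1\<close> and depends on \<open>R\<close> only;
     the tolerance \<open>e / K\<close> is therefore available before \<open>m\<close>\<close>
  define K where "K = curvature (CARD('a) ^ (2 * R + 1))"
  have K: "1 \<le> K" unfolding K_def by (intro curvature_ge_1) (simp add: Suc_le_eq)
  \<comment> \<open>four errors of size \<open>e\<close> occur: two from \<open>\<delta>\<close>, one from \<open>c * t\<close> and one from the constant \<open>b\<close>\<close>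
  define e where "e = min 1 (\<epsilon> / 4)"
  have e: "0 < e" "e \<le> 1" "4 * e \<le> \<epsilon>" using \<epsilon> by (auto simp: e_def)
  obtain m where m: "1 \<le> m" and
    gap: "\<bar>h_top (SFT_cover X m) - h_top (SFT_cover X (m + (4 * R + 1)))\<bar>
        < (e / K)\<^sup>2 / ((4 / 3) ^ (2 * 1) * (\<xi> (card (words (SFT_cover X m) m)))\<^sup>2)"
  proof -
    have "0 < e / K" using e K by simp
    then show ?thesis
      using stable that unfolding entropy_stable_def
      by (metis le_add2 order_refl)
  qed
  define Y where "Y = SFT_cover X m"
  define Z where "Z = SFT_cover X (m + (4 * R + 1))"
  define M where "M = max m (2 * R + 1)"
  define \<Xi> where "\<Xi> = (\<xi> (card (words Y m)))\<^sup>2"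
  define c where "c = curvature (card (words Y M))"
  obtain y0 where y0: "y0 \<in> X" using X_ne by blast
  have XY: "X \<subseteq> Y" and XZ: "X \<subseteq> Z"
    using subset_SFT_cover[of m X] subset_SFT_cover[of "m + (4 * R + 1)" X] m by (auto simp: Y_def Z_def)
  have card_pos: "1 \<le> card (words W k)" if "X \<subseteq> W" for W and k
  proof -
    have "words W k \<noteq> {}" using win_in_words[of y0 W 0 k] y0 that by blast
    then show ?thesis using finite_words[of W k] by (simp add: Suc_le_eq card_gt_0_iff)
  qed
  have xi1: "1 \<le> \<Xi>"
    using xi_bounds(1)[OF card_pos[OF XY, of m]] by (simp add: \<Xi>_def)
  have c_le: "c \<le> K * \<Xi>"
  proof (cases "2 * R + 1 \<le> m")
    case True
    then have "c = curvature (card (words Y m))" by (simp add: c_def M_def)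
    also have "\<dots> \<le> \<Xi>" unfolding \<Xi>_def by (rule xi_bounds(2)[OF card_pos[OF XY]])
    also have "\<dots> \<le> K * \<Xi>" using K xi1 by simp
    finally show ?thesis .
  next
    case False
    then have M: "M = 2 * R + 1" by (simp add: M_def)
    have "c \<le> K"
      unfolding c_def K_def M by (intro curvature_mono card_pos XY card_words_le)
    also have "\<dots> \<le> K * \<Xi>" using K xi1 by simp
    finally show ?thesis .
  qed
  have c1: "1 \<le> c" unfolding c_def by (intro curvature_ge_1 card_pos XY)
  \<comment> \<open>large enough for \<open>\<delta> / t \<le> e\<close> and small enough for \<open>c * t \<le> e\<close>\<close>
  define t where "t = e / (K * \<Xi>)"
  have KX: "1 \<le> K * \<Xi>" using mult_mono[of 1 K 1 \<Xi>] K xi1 by simp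
  have t: "0 < t" using e KX by (simp add: t_def)
  have tc: "t * c \<le> e"
  proof -
    have "t * c \<le> t * (K * \<Xi>)" using t c_le by (intro mult_left_mono) auto
    also have "\<dots> = e" using K xi1 by (simp add: t_def)
    finally show ?thesis .
  qed
  define \<delta> where "\<delta> = h_top Y - h_top Z"
  have "(e / K)\<^sup>2 / ((4 / 3) ^ (2 * 1) * \<Xi>) \<le> (e / K)\<^sup>2 / \<Xi>"
    using xi1 by (intro divide_left_mono) (auto simp: power2_eq_square)
  then have \<delta>: "\<delta> \<le> (e / K)\<^sup>2 / \<Xi>"
    using gap by (simp add: \<delta>_def Y_def Z_def \<Xi>_def)
  have \<delta>t: "2 * \<delta> \<le> t * (2 * e)"
  proof -
    have "2 * \<delta> \<le> 2 * ((e / K)\<^sup>2 / \<Xi>)" using \<delta> by simp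
    also have "\<dots> = t * (2 * e / K)" using K xi1 by (simp add: t_def power2_eq_square field_simps)
    also have "\<dots> \<le> t * (2 * e)" using t e K by (intro mult_left_mono) (auto simp: divide_le_eq)
    finally show ?thesis .
  qed

  have "\<forall>p\<in>P. \<exists>B. \<forall>n\<ge>m + (4 * R + 1). \<forall>x. (\<forall>w\<in>words Z n. x w \<in> Z \<and> win (x w) 0 n = w) \<longrightarrow>
      t * \<bar>(\<Sum>w\<in>words Z n. visits n (fst p) (x w)) - (\<Sum>w\<in>words Z n. visits n (snd p) (x w))\<bar>
      \<le> card (words Z n) * (n * (2 * h_top Y - 2 * h_top Z + c * t\<^sup>2) + B)"
  proof
    fix p assume p: "p \<in> P"
    obtain \<phi> \<psi> r where qp: "q p = (\<phi>, \<psi>, r)" by (cases "q p")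
    have code_facts: "\<phi> \<in> Aut X" "\<And>x. x \<in> X \<Longrightarrow> x \<in> snd p \<longleftrightarrow> \<phi> x \<in> fst p" "\<And>x. x \<in> X \<Longrightarrow> \<psi> (\<phi> x) = x"
        "block_code r X \<phi>" "block_code r X \<psi>"
      using bspec[OF q p] unfolding qp by auto
    have r: "r \<le> R" using Rq[OF p] qp by simp
    interpret extended_automorphism X \<phi> \<psi> R m
      by unfold_locales (use X code_facts m block_code_mono[OF _ r] in auto)
    show "\<exists>B. \<forall>n\<ge>m + (4 * R + 1). \<forall>x. (\<forall>w\<in>words Z n. x w \<in> Z \<and> win (x w) 0 n = w) \<longrightarrow>
      t * \<bar>(\<Sum>w\<in>words Z n. visits n (fst p) (x w)) - (\<Sum>w\<in>words Z n. visits n (snd p) (x w))\<bar>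
      \<le> card (words Z n) * (n * (2 * h_top Y - 2 * h_top Z + c * t\<^sup>2) + B)"
      unfolding Z_def Y_def c_def
    proof (rule frequencies_close[OF trans])
      show "m \<le> M" "2 * R + 1 \<le> M" by (auto simp: M_def)
      show "window_set R (fst p)" "window_set R (snd p)" using win_R[of "fst p" "snd p"] p by auto
      show "0 < t" by fact
      show "t * curvature (card (words (SFT_cover X m) M)) \<le> 1" using tc e by (simp add: c_def Y_def)
    qed (rule code_facts(2))
  qed
  from bchoice[OF this] obtain B where B: "\<And>p n x. p \<in> P \<Longrightarrow> m + (4 * R + 1) \<le> n \<Longrightarrow>
      (\<forall>w\<in>words Z n. x w \<in> Z \<and> win (x w) 0 n = w) \<Longrightarrow>
      t * \<bar>(\<Sum>w\<in>words Z n. visits n (fst p) (x w)) - (\<Sum>w\<in>words Z n. visits n (snd p) (x w))\<bar>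
      \<le> card (words Z n) * (n * (2 * h_top Y - 2 * h_top Z + c * t\<^sup>2) + B p)"
    by blast
  define b where "b = (\<Sum>p\<in>P. \<bar>B p\<bar>)"
  have b: "B p \<le> b" if "p \<in> P" for p
    unfolding b_def using member_le_sum[of p P "\<lambda>p. \<bar>B p\<bar>"] that P by force
  obtain n where n: "m + (4 * R + 1) \<le> n" "b / (t * e) \<le> n"
  proof -
    obtain k where "b / (t * e) \<le> real k" using real_arch_simple by blast
    then show ?thesis using that[of "max k (m + (4 * R + 1))"] by simp
  qed
  have n_pos: "0 < real n" using n(1) by simp
  have bn: "b \<le> n * (t * e)" using n(2) t e by (simp add: divide_le_eq)
  define I where "I = words Z n"
  have I: "finite I" "I \<noteq> {}" using finite_words[of Z n] card_pos[OF XZ, of n] by (auto simp: I_def)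
  have "\<forall>w\<in>I. \<exists>x. x \<in> Z \<and> win x 0 n = w"
  proof
    fix w assume "w \<in> I"
    then obtain z i where z: "z \<in> Z" "w = win z i n" by (auto simp: I_def words_iff)
    have "translate i z \<in> Z"
    proof -
      have "win (translate i z) k (m + (4 * R + 1)) = win z (k + i) (m + (4 * R + 1))" for k
        by (simp add: win_eq_iff algebra_simps)
      then show ?thesis using z(1) m unfolding Z_def by (subst SFT_cover_iff) (auto simp: SFT_cover_iff)
    qed
    moreover have "win (translate i z) 0 n = w" using z by (simp add: win_eq_iff algebra_simps)
    ultimately show "\<exists>x. x \<in> Z \<and> win x 0 n = w" by blast
  qed
  from bchoice[OF this] obtain x where x: "\<forall>w\<in>I. x w \<in> Z \<and> win (x w) 0 n = w" by blast
  define g where "g C = (\<Sum>w\<in>I. visits n C (x w)) / (n * card I)" for C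
  have card_I: "0 < real (card I)" using I by (simp add: card_gt_0_iff)
  have "content g" unfolding g_def using frequency_content[OF I] n_pos by simp
  moreover have "g A = 1" if A: "window_set R0 A" "X \<subseteq> A" for A
  proof -
    have "translate i z \<in> A" if z: "z \<in> Z" for i z
    proof -
      obtain y where y: "y \<in> X" "\<forall>k\<in>{i - int R..i + int R}. y k = z k"
        using SFT_cover_local[OF X z[unfolded Z_def], of "i + int R" "i - int R"] by auto
      have "translate i y \<in> A" using subshift_translate[OF X y(1)] A by blast
      moreover have "translate i y \<in> A \<longleftrightarrow> translate i z \<in> A"
        by (rule window_setD[OF window_set_mono[OF A(1) R0]]) (use y in \<open>auto simp: abs_le_iff\<close>)
      ultimately show ?thesis by simp
    qed
    then have "visits n A (x w) = n" if "w \<in> I" for w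
      using x that by (simp add: visits_def)
    then show ?thesis using n_pos card_I by (simp add: g_def)
  qed
  moreover have "\<bar>g C - g D\<bar> \<le> \<epsilon>" if p: "(C, D) \<in> P" for C D
  proof -
    define \<Delta> where "\<Delta> = \<bar>(\<Sum>w\<in>I. visits n C (x w)) - (\<Sum>w\<in>I. visits n D (x w))\<bar>"
    have "t * \<Delta> \<le> card I * (n * (2 * h_top Y - 2 * h_top Z + c * t\<^sup>2) + B (C, D))"
      using B[OF p n(1), of x] x by (simp add: \<Delta>_def I_def)
    also have "\<dots> \<le> card I * (n * (t * (2 * e) + t * e) + n * (t * e))"
    proof (intro mult_left_mono add_mono)
      show "2 * h_top Y - 2 * h_top Z \<le> t * (2 * e)" using \<delta>t by (simp add: \<delta>_def)
      have "c * t\<^sup>2 = t * (t * c)" by (simp add: power2_eq_square)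
      also have "\<dots> \<le> t * e" using tc t by (intro mult_left_mono) auto
      finally show "c * t\<^sup>2 \<le> t * e" .
      show "B (C, D) \<le> n * (t * e)" using b[OF p] bn by linarith
    qed auto
    also have "\<dots> = t * (4 * e * (n * card I))" by (simp add: algebra_simps)
    finally have "\<Delta> \<le> 4 * e * (n * card I)" using t by simp
    then have "\<Delta> / (n * card I) \<le> 4 * e" using n_pos card_I by (simp add: divide_le_eq)
    moreover have "\<bar>g C - g D\<bar> = \<Delta> / (n * card I)"
      using n_pos card_I by (simp add: g_def \<Delta>_def abs_divide flip: diff_divide_distrib)
    ultimately show ?thesis using e by simp
  qed
  ultimately show ?thesis by blast
qed

text \<open>
  Compactness: each index of the family \<open>T\<close> imposes additivity, one full-mass condition and one
  approximate invariance, all closed; finitely many of them have a common radius and a common tolerance.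
\<close>

lemma invariant_content:
  fixes X :: "(int \<Rightarrow> 'a :: {finite, discrete_topology}) set"
  assumes stable: "entropy_stable X"
  shows "\<exists>g. content g \<and> (\<forall>R A. window_set R A \<and> X \<subseteq> A \<longrightarrow> g A = 1) \<and>
    (\<forall>R C D. window_set R C \<and> window_set R D \<and> corresponding X C D \<longrightarrow> g C = g D)"
proof -
  define Q where "Q = {g :: (int \<Rightarrow> 'a) set \<Rightarrow> real. \<forall>A. g A \<in> {0..1}}"
  define J where "J = {(C, D, A, k :: nat). (\<exists>R. window_set R C \<and> window_set R D \<and> window_set R A)
      \<and> corresponding X C D \<and> X \<subseteq> A}"
  define T where "T = (\<lambda>(C, D, A, k :: nat). {g :: (int \<Rightarrow> 'a) set \<Rightarrow> real.
      (\<forall>A B. A \<inter> B = {} \<longrightarrow> g (A \<union> B) = g A + g B) \<and> g A = 1 \<and> \<bar>g C - g D\<bar> \<le> 1 / (real k + 1)})"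
  have "Q \<inter> (\<Inter>j\<in>J. T j) \<noteq> {}"
  proof (rule compact_imp_fip_image)
    show "compact Q" unfolding Q_def by (intro compact_pointwise_box) simp
    show "closed (T j)" if "j \<in> J" for j
      unfolding T_def
      by (cases j) (auto intro!: closed_Collect_conj closed_Collect_all closed_Collect_imp closed_Collect_eq
          closed_Collect_le continuous_intros continuous_on_product_coordinates)
    fix J' assume J': "finite J'" "J' \<subseteq> J"
    have "\<forall>j\<in>J'. \<exists>R. case j of (C, D, A, k) \<Rightarrow> window_set R C \<and> window_set R D \<and> window_set R A"
      using J' by (auto simp: J_def)
    from bchoice[OF this] obtain r where
      r: "\<forall>j\<in>J'. case j of (C, D, A, k) \<Rightarrow> window_set (r j) C \<and> window_set (r j) D \<and> window_set (r j) A"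
      by blast
    define R where "R = Max (insert 0 (r ` J'))"
    have rR: "r j \<le> R" if "j \<in> J'" for j unfolding R_def using that J' by (intro Max_ge) auto
    define k where "k = Max (insert 0 ((\<lambda>(C, D, A, k). k) ` J'))"
    have kk: "k' \<le> k" if "(C, D, A, k') \<in> J'" for C D A k'
      unfolding k_def using that J' by (intro Max_ge) (auto intro: rev_image_eqI)
    define P where "P = (\<lambda>(C, D, A, k). (C, D)) ` J'"
    have "\<exists>g. content g \<and> (\<forall>A. window_set R A \<and> X \<subseteq> A \<longrightarrow> g A = 1) \<and>
        (\<forall>(C, D)\<in>P. \<bar>g C - g D\<bar> \<le> 1 / (real k + 1))"
    proof (rule almost_invariant_content[OF stable])
      show "finite P" using J' by (simp add: P_def)
      fix C D assume "(C, D) \<in> P"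
      then obtain A k' where j: "(C, D, A, k') \<in> J'" by (auto simp: P_def)
      then show "window_set R C \<and> window_set R D \<and> corresponding X C D"
        using bspec[OF r j] window_set_mono[OF _ rR[OF j]] J' unfolding J_def by blast
    qed simp
    then obtain g where g: "content g" "\<And>A. window_set R A \<Longrightarrow> X \<subseteq> A \<Longrightarrow> g A = 1"
        "\<And>C D. (C, D) \<in> P \<Longrightarrow> \<bar>g C - g D\<bar> \<le> 1 / (real k + 1)" by blast
    have "g \<in> T j" if j: "j \<in> J'" for j
    proof -
      obtain C D A k' where jj: "j = (C, D, A, k')" by (cases j)
      have "window_set (r j) A" using bspec[OF r j] by (simp add: jj)
      then have "window_set R A" by (rule window_set_mono[OF _ rR[OF j]])
      then have "g A = 1" using g(2) j J' by (auto simp: jj J_def)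
      have "(C, D) \<in> P" using j by (auto simp: P_def jj intro: rev_image_eqI)
      then have "\<bar>g C - g D\<bar> \<le> 1 / (real k + 1)" by (rule g(3))
      also have "\<dots> \<le> 1 / (real k' + 1)"
        using kk j by (intro divide_left_mono) (auto simp: jj)
      finally show ?thesis using g(1) \<open>g A = 1\<close> by (simp add: T_def jj content_def)
    qed
    moreover have "g \<in> Q" using g(1) by (simp add: Q_def content_def)
    ultimately show "Q \<inter> (\<Inter>j\<in>J'. T j) \<noteq> {}" by blast
  qed
  then obtain g where gQ: "g \<in> Q" and gT: "\<And>j. j \<in> J \<Longrightarrow> g \<in> T j" by blast
  have univ: "window_set 0 (UNIV :: (int \<Rightarrow> 'a) set)" by (simp add: window_set_def)
  have "(\<lambda>x. x) \<in> Aut X" by (auto simp: Aut_def homeomorphism_def intro!: exI[of _ "\<lambda>x. x"])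
  then have self: "corresponding X UNIV UNIV" by (auto simp: corresponding_def)
  have "content g"
    using gQ gT[of "(UNIV, UNIV, UNIV, 0)"] univ self by (auto simp: content_def Q_def J_def T_def)
  moreover have "g A = 1" if "window_set R A" "X \<subseteq> A" for R A
  proof -
    have "window_set R (UNIV :: (int \<Rightarrow> 'a) set)" by (simp add: window_set_def)
    then have "(UNIV, UNIV, A, 0) \<in> J" using that self by (auto simp: J_def)
    then show ?thesis using gT[of "(UNIV, UNIV, A, 0)"] by (simp add: T_def)
  qed
  moreover have "g C = g D" if CD: "window_set R C" "window_set R D" "corresponding X C D" for R C D
  proof -
    have "\<bar>g C - g D\<bar> \<le> 1 / (real k + 1)" for k
    proof -
      have "window_set R (UNIV :: (int \<Rightarrow> 'a) set)" by (simp add: window_set_def)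
      then have "(C, D, UNIV, k) \<in> J" using CD by (auto simp: J_def)
      then show ?thesis using gT[of "(C, D, UNIV, k)"] by (simp add: T_def)
    qed
    moreover have "(\<lambda>k. 1 / (real k + 1)) \<longlonglongrightarrow> 0"
      using LIMSEQ_inverse_real_of_nat by (simp add: inverse_eq_divide add.commute)
    ultimately have "\<bar>g C - g D\<bar> \<le> 0" by (intro LIMSEQ_le_const) auto
    then show ?thesis by simp
  qed
  ultimately show ?thesis by blast
qed

section \<open>Extension to a Borel measure\<close>

definition cylinder_algebra :: "(int \<Rightarrow> 'a) set set" where
  "cylinder_algebra = {C. \<exists>R. window_set R C}"

lemma window_setI:
  fixes C :: "(int \<Rightarrow> 'a) set"
  assumes "\<And>x y. (\<And>k. \<bar>k\<bar> \<le> int R \<Longrightarrow> x k = y k) \<Longrightarrow> x \<in> C \<Longrightarrow> y \<in> C"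
  shows "window_set R C"
  unfolding window_set_def
proof (intro allI impI)
  fix x y :: "int \<Rightarrow> 'a" assume "\<forall>k\<in>{- int R..int R}. x k = y k" "x \<in> C"
  then show "y \<in> C" by (intro assms[of x y]) (auto simp: abs_le_iff)
qed

lemma window_set_Compl: "window_set R C \<Longrightarrow> window_set R (- C)"
  by (rule window_setI) (auto dest: window_setD)

lemma window_set_Un:
  assumes "window_set R C" "window_set R' D"
  shows "window_set (max R R') (C \<union> D)"
proof (rule window_setI)
  fix x y assume eq: "\<And>k. \<bar>k\<bar> \<le> int (max R R') \<Longrightarrow> x k = y k" and "x \<in> C \<union> D"
  moreover have "x \<in> C \<longleftrightarrow> y \<in> C" by (rule window_setD[OF assms(1)]) (use eq in auto)
  moreover have "x \<in> D \<longleftrightarrow> y \<in> D" by (rule window_setD[OF assms(2)]) (use eq in auto)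
  ultimately show "y \<in> C \<union> D" by blast
qed

lemma window_set_UNIV: "window_set R UNIV"
  by (simp add: window_set_def)

lemma algebra_cylinder: "algebra UNIV (cylinder_algebra :: (int \<Rightarrow> 'a) set set)"
  unfolding algebra_iff_Un cylinder_algebra_def
proof (intro conjI ballI)
  show "{} \<in> {C :: (int \<Rightarrow> 'a) set. \<exists>R. window_set R C}"
    using window_set_Compl[OF window_set_UNIV] by auto
qed (auto intro: window_set_Compl window_set_Un simp flip: Compl_eq_Diff_UNIV)

text \<open>
  The smallest set that contains \<open>A\<close> and depends only on the coordinates in \<open>[-R, R]\<close>.
\<close>

definition saturation :: "nat \<Rightarrow> (int \<Rightarrow> 'a) set \<Rightarrow> (int \<Rightarrow> 'a) set" where
  "saturation R A = {x. \<exists>y\<in>A. \<forall>k\<in>{- int R..int R}. x k = y k}"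

lemma window_set_saturation: "window_set R (saturation R A)"
  by (rule window_setI) (auto simp: saturation_def abs_le_iff)

lemma subset_saturation: "A \<subseteq> saturation R A"
  by (auto simp: saturation_def)

lemma saturation_antimono: "R \<le> R' \<Longrightarrow> saturation R' A \<subseteq> saturation R A"
  unfolding saturation_def by (fastforce intro: bexI)

lemma window_set_open:
  fixes C :: "(int \<Rightarrow> 'a :: discrete_topology) set"
  assumes "window_set R C"
  shows "open C"
proof -
  have "C = (\<Union>x\<in>C. {y. \<forall>k\<in>{- int R..int R}. y k = x k})"
  proof (intro equalityI subsetI)
    fix y assume "y \<in> (\<Union>x\<in>C. {y. \<forall>k\<in>{- int R..int R}. y k = x k})"
    then obtain x where x: "x \<in> C" "\<forall>k\<in>{- int R..int R}. y k = x k" by blast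
    have "x \<in> C \<longleftrightarrow> y \<in> C" by (rule window_setD[OF assms]) (use x(2) in \<open>simp add: abs_le_iff\<close>)
    then show "y \<in> C" using x(1) by simp
  qed auto
  also have "open \<dots>" by (intro open_UN ballI open_cylinder)
  finally show ?thesis .
qed

lemma window_set_closed:
  fixes C :: "(int \<Rightarrow> 'a :: discrete_topology) set"
  shows "window_set R C \<Longrightarrow> closed C"
  unfolding closed_def by (intro window_set_open window_set_Compl)

lemma closed_eq_Inter_saturation:
  fixes X :: "(int \<Rightarrow> 'a :: discrete_topology) set"
  assumes "closed X"
  shows "(\<Inter>R. saturation R X) = X"
proof (intro equalityI subsetI)
  fix x assume x: "x \<in> (\<Inter>R. saturation R X)"
  show "x \<in> X"
  proof (rule ccontr)
    assume "x \<notin> X"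
    then obtain R where R: "\<forall>y. (\<forall>k\<in>{- int R..int R}. y k = x k) \<longrightarrow> y \<in> - X"
      using open_contains_cylinder[of "- X" x] assms by (auto simp: closed_def)
    then show False using x by (fastforce simp: saturation_def)
  qed
qed (use subset_saturation in blast)

text \<open>
  Complements of saturations exhaust an open set from inside along the single index \<open>R\<close>, which replaces
  a countable base.
\<close>

lemma sigma_cylinder_borel:
  "sigma_sets UNIV (cylinder_algebra :: (int \<Rightarrow> 'a :: discrete_topology) set set) = sets borel"
proof -
  have "sets (borel :: (int \<Rightarrow> 'a) measure) = sigma_sets UNIV {S. open S}"
    by (simp add: borel_def)
  also have "\<dots> = sigma_sets UNIV cylinder_algebra"
  proof (rule sigma_sets_eqI)
    fix U :: "(int \<Rightarrow> 'a) set" assume "U \<in> {S. open S}"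
    then have "- U = (\<Inter>R. saturation R (- U))"
      using closed_eq_Inter_saturation[of "- U"] by (simp add: closed_def)
    then have "U = (\<Union>R. - saturation R (- U))" by blast
    also have "\<dots> \<in> sigma_sets UNIV cylinder_algebra"
      by (intro sigma_sets.Union sigma_sets.Basic)
        (auto simp: cylinder_algebra_def intro: window_set_Compl window_set_saturation)
    finally show "U \<in> sigma_sets UNIV cylinder_algebra" .
  next
    fix C :: "(int \<Rightarrow> 'a) set" assume "C \<in> cylinder_algebra"
    then show "C \<in> sigma_sets UNIV {S. open S}"
      by (auto simp: cylinder_algebra_def intro: window_set_open)
  qed
  finally show ?thesis ..
qed

text \<open>
  A decreasing sequence of window sets with empty intersection reaches the empty set after finitely
  many steps, since window sets are closed in a compact space. Continuity at the empty set is then trivial.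
\<close>

lemma content_extends:
  fixes g :: "(int \<Rightarrow> 'a :: {finite, discrete_topology}) set \<Rightarrow> real"
  assumes g: "content g"
  shows "\<exists>N. sets N = sets borel \<and> (\<forall>R C. window_set R C \<longrightarrow> emeasure N C = ennreal (g C))"
proof -
  interpret algebra UNIV "cylinder_algebra :: (int \<Rightarrow> 'a) set set" by (rule algebra_cylinder)
  have add: "g (A \<union> B) = g A + g B" if "A \<inter> B = {}" for A B using g that unfolding content_def by blast
  have "g A \<in> {0..1}" for A using g unfolding content_def by blast
  then have nonneg: "0 \<le> g A" for A by simp
  have empty: "g {} = 0" using add[of "{}" "{}"] by simp
  have "\<exists>\<mu>. (\<forall>s\<in>cylinder_algebra. \<mu> s = ennreal (g s)) \<and>
      measure_space (UNIV :: (int \<Rightarrow> 'a) set) (sigma_sets UNIV cylinder_algebra) \<mu>"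
  proof (rule caratheodory_empty_continuous)
    show "positive cylinder_algebra (\<lambda>s. ennreal (g s))" by (simp add: positive_def empty)
    show "additive cylinder_algebra (\<lambda>s. ennreal (g s))"
      unfolding additive_def by (intro ballI impI) (simp only: add ennreal_plus[OF nonneg nonneg])
    fix A :: "nat \<Rightarrow> (int \<Rightarrow> 'a) set"
    assume A: "range A \<subseteq> cylinder_algebra" "decseq A" "(\<Inter>i. A i) = {}"
    have "\<exists>i. A i = {}"
    proof (rule ccontr)
      assume ne: "\<nexists>i. A i = {}"
      have "UNIV \<inter> (\<Inter>i\<in>UNIV. A i) \<noteq> {}"
      proof (rule compact_imp_fip_image[OF compact_full_shift])
        show "closed (A i)" for i
        proof -
          have "A i \<in> cylinder_algebra" using A(1) by blast
          then obtain R where "window_set R (A i)" unfolding cylinder_algebra_def by blast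
          then show ?thesis by (rule window_set_closed)
        qed
        fix I :: "nat set" assume I: "finite I"
        define n where "n = Max (insert 0 I)"
        have "A n \<subseteq> A i" if "i \<in> I" for i
          by (rule decseqD[OF A(2)]) (use that I in \<open>simp add: n_def\<close>)
        moreover have "A n \<noteq> {}" using ne by simp
        ultimately show "UNIV \<inter> (\<Inter>i\<in>I. A i) \<noteq> {}" by blast
      qed
      then show False using A(3) by simp
    qed
    then obtain i where i: "A i = {}" by blast
    have "\<forall>\<^sub>F n in sequentially. ennreal (g (A n)) = 0"
      using eventually_ge_at_top[of i]
    proof eventually_elim
      case (elim n)
      then have "A n = {}" using decseqD[OF A(2) elim] i by simp
      then show ?case by (simp add: empty)
    qed
    then show "(\<lambda>n. ennreal (g (A n))) \<longlonglongrightarrow> 0" by (rule tendsto_eventually)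
  qed simp
  then obtain \<mu> where \<mu>: "\<And>s. s \<in> cylinder_algebra \<Longrightarrow> \<mu> s = ennreal (g s)"
    "measure_space (UNIV :: (int \<Rightarrow> 'a) set) (sigma_sets UNIV cylinder_algebra) \<mu>" by blast
  define N where "N = measure_of UNIV cylinder_algebra \<mu>"
  have sets_N: "sets N = sigma_sets UNIV cylinder_algebra"
    unfolding N_def by (rule sets_measure_of) simp
  then have "sets N = sets borel" by (simp only: sigma_cylinder_borel)
  moreover have "emeasure N C = ennreal (g C)" if "window_set R C" for R C
  proof -
    have C: "C \<in> cylinder_algebra" using that by (auto simp: cylinder_algebra_def)
    have "emeasure N C = \<mu> C"
    proof (rule emeasure_measure_of[OF N_def])
      show "positive (sets N) \<mu>" "countably_additive (sets N) \<mu>"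
        using \<mu>(2) unfolding sets_N measure_space_def by blast+
      show "C \<in> sets N" unfolding sets_N using C by (rule sigma_sets.Basic)
    qed simp
    then show ?thesis using \<mu>(1)[OF C] by simp
  qed
  ultimately show ?thesis by blast
qed

text \<open>
  The preimage of \<open>C\<close> is a subset of \<open>X\<close> only; its saturation is a window set with the same trace on \<open>X\<close>.
\<close>

lemma Aut_preimage_window:
  fixes X :: "(int \<Rightarrow> 'a :: {finite, discrete_topology}) set"
  assumes X: "subshift X" and \<phi>: "\<phi> \<in> Aut X" and C: "window_set R C"
  shows "\<exists>R' D. R \<le> R' \<and> window_set R' D \<and> (\<forall>x\<in>X. x \<in> D \<longleftrightarrow> \<phi> x \<in> C)"
proof -
  obtain r where r: "block_code r X \<phi>" using Aut_block_code[OF X \<phi>] by blast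
  define D where "D = saturation (R + r) {x \<in> X. \<phi> x \<in> C}"
  have "x \<in> D \<longleftrightarrow> \<phi> x \<in> C" if x: "x \<in> X" for x
  proof
    assume "x \<in> D"
    then obtain y where y: "y \<in> X" "\<phi> y \<in> C" "\<forall>k\<in>{- int (R + r)..int (R + r)}. x k = y k"
      by (auto simp: D_def saturation_def)
    have "\<phi> x k = \<phi> y k" if "\<bar>k\<bar> \<le> int R" for k
    proof -
      have "\<forall>j\<in>{k - int r..k + int r}. x j = y j" using y(3) that by (auto simp: abs_le_iff)
      then show ?thesis using r x y(1) unfolding block_code_def by blast
    qed
    then show "\<phi> x \<in> C" using window_setD[OF C] y(2) by blast
  next
    assume "\<phi> x \<in> C"
    then have "x \<in> {x \<in> X. \<phi> x \<in> C}" using x by simp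
    then show "x \<in> D" unfolding D_def by (rule subsetD[OF subset_saturation])
  qed
  then show ?thesis using window_set_saturation[of "R + r"] unfolding D_def by (meson le_add1)
qed

theorem theorem1p2:
  fixes X :: "(int \<Rightarrow> 'a :: {finite, discrete_topology}) set"
  assumes "subshift X"
    and "topologically_mixing X"
    and "entropy_stable X"
  shows "\<exists>\<mu>. characteristic_measure X \<mu>"
proof -
  have X: "subshift X" by fact
  have clX: "closed X" using X by (simp add: subshift_def)
  then have Xb: "X \<in> sets borel" by (rule borel_closed)
  obtain g where g: "content g" "\<And>R A. window_set R A \<Longrightarrow> X \<subseteq> A \<Longrightarrow> g A = 1"
      "\<And>R C D. window_set R C \<Longrightarrow> window_set R D \<Longrightarrow> corresponding X C D \<Longrightarrow> g C = g D"
    using invariant_content[OF assms(3)] by blast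
  obtain N where N: "sets N = sets borel" "\<And>R C. window_set R C \<Longrightarrow> emeasure N C = ennreal (g C)"
    using content_extends[OF g(1)] by blast
  have spN: "space N = UNIV" using sets_eq_imp_space_eq[OF N(1)] by simp
  have full: "emeasure N UNIV = 1" using N(2)[OF window_set_UNIV] g(2)[OF window_set_UNIV] by simp
  have "emeasure N X = 1"
  proof -
    have "(\<lambda>R. emeasure N (saturation R X)) \<longlonglongrightarrow> emeasure N (\<Inter>R. saturation R X)"
    proof (rule Lim_emeasure_decseq)
      show "range (\<lambda>R. saturation R X) \<subseteq> sets N"
        using N(1) window_set_open[OF window_set_saturation] by (auto intro: borel_open)
      show "decseq (\<lambda>R. saturation R X)" by (intro decseq_SucI saturation_antimono) simp
      show "emeasure N (saturation i X) \<noteq> \<infinity>" for i using N(2)[OF window_set_saturation] by simp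
    qed
    moreover have "emeasure N (saturation R X) = 1" for R
      using N(2)[OF window_set_saturation] g(2)[OF window_set_saturation subset_saturation] by simp
    ultimately show ?thesis
      using closed_eq_Inter_saturation[OF clX] by (simp add: LIMSEQ_const_iff)
  qed
  \<comment> \<open>so masses may be computed with window sets of the full shift instead of their traces on \<open>X\<close>\<close>
  have null: "- X \<in> null_sets N"
  proof -
    have "emeasure N (space N - X) = emeasure N (space N) - emeasure N X"
      using N(1) Xb \<open>emeasure N X = 1\<close> by (intro emeasure_compl) auto
    then have "emeasure N (- X) = 0"
      using \<open>emeasure N X = 1\<close> full spN by (simp add: Compl_eq_Diff_UNIV)
    then show ?thesis using N(1) Xb by (auto simp: null_sets_def)
  qed
  have inter: "emeasure N (C \<inter> X) = ennreal (g C)" if C: "window_set R C" for R C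
  proof -
    have "C \<in> sets N" using window_set_open[OF C] N(1) by (auto intro: borel_open)
    then have "emeasure N (C - (- X)) = emeasure N C" using null by (rule emeasure_Diff_null_set[rotated])
    moreover have "C - (- X) = C \<inter> X" by blast
    ultimately show ?thesis using N(2)[OF C] by simp
  qed
  define \<mu> where "\<mu> = restrict_space N X"
  have sp: "space \<mu> = X" by (simp add: \<mu>_def space_restrict_space spN)
  have em: "emeasure \<mu> A = emeasure N A" if "A \<subseteq> X" for A
    unfolding \<mu>_def using that N(1) Xb spN by (intro emeasure_restrict_space) auto
  have sets_\<mu>: "sets \<mu> = sets (restrict_space borel X)"
    unfolding \<mu>_def using N(1) by (intro restrict_space_sets_cong) auto
  define G where "G = (\<inter>) X ` (cylinder_algebra :: (int \<Rightarrow> 'a) set set)"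
  have sets_G: "sets \<mu> = sigma_sets X G"
  proof -
    have "sets \<mu> = (\<inter>) X ` sigma_sets UNIV cylinder_algebra"
      by (simp add: \<mu>_def sets_restrict_space N(1) sigma_cylinder_borel)
    also have "\<dots> = sigma_sets X G"
      unfolding G_def using Xb by (intro sigma_sets_Int) (auto simp: sigma_cylinder_borel)
    finally show ?thesis .
  qed
  have "prob_space \<mu>" using em[of X] sp \<open>emeasure N X = 1\<close> by (intro prob_spaceI) simp
  moreover have "distr \<mu> \<mu> \<phi> = \<mu>" if \<phi>: "\<phi> \<in> Aut X" for \<phi>
  proof -
    have cont: "continuous_on X \<phi>" using \<phi> by (auto simp: Aut_def homeomorphism_def)
    have meas: "\<phi> \<in> measurable \<mu> \<mu>"
    proof -
      have "\<phi> \<in> measurable (restrict_space borel X) borel"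
        by (rule borel_measurable_continuous_on_restrict[OF cont])
      then have "\<phi> \<in> measurable (restrict_space borel X) (restrict_space borel X)"
        using Aut_maps_to[OF \<phi>] by (intro measurable_restrict_space2) (auto simp: space_restrict_space)
      then show ?thesis using measurable_cong_sets[OF sets_\<mu> sets_\<mu>] by simp
    qed
    show ?thesis
    proof (rule measure_eqI_generator_eq[where E = G and \<Omega> = X and A = "\<lambda>_. X"])
      show "Int_stable G"
      proof (rule Int_stableI)
        fix a b assume "a \<in> G" "b \<in> G"
        then obtain C D R R' where CD: "a = X \<inter> C" "b = X \<inter> D" "window_set R C" "window_set R' D"
          by (auto simp: G_def cylinder_algebra_def)
        have "window_set (max R R') (- (- C \<union> - D))"
          using CD by (intro window_set_Compl window_set_Un)
        then have "C \<inter> D \<in> cylinder_algebra" by (auto simp: cylinder_algebra_def)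
        moreover have "a \<inter> b = X \<inter> (C \<inter> D)" using CD by blast
        ultimately show "a \<inter> b \<in> G" unfolding G_def by blast
      qed
      show "G \<subseteq> Pow X" by (auto simp: G_def)
      show "range (\<lambda>_. X) \<subseteq> G"
        using window_set_UNIV by (auto simp: G_def cylinder_algebra_def intro!: image_eqI[of _ _ UNIV])
      show "sets (distr \<mu> \<mu> \<phi>) = sigma_sets X G" "sets \<mu> = sigma_sets X G" by (simp_all add: sets_G)
      show "emeasure (distr \<mu> \<mu> \<phi>) X \<noteq> \<infinity>"
      proof -
        interpret prob_space \<mu> by fact
        interpret D: prob_space "distr \<mu> \<mu> \<phi>" by (rule prob_space_distr[OF meas])
        show ?thesis by simp
      qed
      fix a assume "a \<in> G"
      then obtain C R where C: "a = X \<inter> C" "window_set R C" by (auto simp: G_def cylinder_algebra_def)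
      obtain R' D where D: "R \<le> R'" "window_set R' D" "\<And>x. x \<in> X \<Longrightarrow> x \<in> D \<longleftrightarrow> \<phi> x \<in> C"
        using Aut_preimage_window[OF X \<phi> C(2)] by blast
      have "a \<in> sets \<mu>" using \<open>a \<in> G\<close> sets_G by auto
      then have "emeasure (distr \<mu> \<mu> \<phi>) a = emeasure \<mu> (\<phi> -` a \<inter> X)"
        using emeasure_distr[OF meas] sp by simp
      also have "\<phi> -` a \<inter> X = D \<inter> X" using C D(3) Aut_maps_to[OF \<phi>] by auto
      also have "emeasure \<mu> (D \<inter> X) = ennreal (g D)" using em[of "D \<inter> X"] inter[OF D(2)] by simp
      also have "g D = g C"
      proof -
        have "corresponding X C D" unfolding corresponding_def by (intro bexI[of _ \<phi>] ballI D(3) \<phi>)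
        then show ?thesis using g(3)[OF window_set_mono[OF C(2) D(1)] D(2)] by simp
      qed
      also have "ennreal (g C) = emeasure \<mu> a"
        using em[of a] inter[OF C(2)] C(1) by (simp add: Int_commute)
      finally show "emeasure (distr \<mu> \<mu> \<phi>) a = emeasure \<mu> a" .
    qed auto
  qed
  ultimately show ?thesis using sets_\<mu> unfolding characteristic_measure_def by blast
qed

end
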